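(* Fix positive integers $d,m_1,\dots,m_s$ and let $S_1=(1,2,\dots,d,d+1)$. Assume inductively, for $j=1,\dots,s$, that $S_j$ is $m_j$-reducible, with $m_j$-reduction equal to $S_{j+1}$ (trailing zeros deleted). If $\operatorname{size}(S_{s+1})>0$, then the linear system $\mathcal{L}(d;m_1,\dots,m_s)$, with the multiplicities imposed at general points of $\mathbb{P}^2$, is $h^1$-regular.
   Context: Linear systems (over $\mathbb{C}$). $\mathcal{L}(d;m_1,\dots,m_s)$ is the linear system of curves of degree $d$ in $\mathbb{P}^2$ vanishing to order at least $m_i$ at $P_i$, $i=1,\dots,s$. Its virtual dimension is $\operatorname{vdim}=\binom{d+2}{2}-\sum_{i=1}^s\binom{m_i+1}{2}-1$, its expected dimension is $\max\{\operatorname{vdim},-1\}$, and the empty system has dimension $-1$. The system is non-special if its (projective) dimension equals the expected dimension. It is $h^1$-regular if it is non-special and effective (nonempty). "General points" means: for all $(P_1,\dots,P_s)$ in some nonempty Zariski open subset of $(\mathbb{P}^2)^s$ (depending on the numerical data). Size. For a finite sequence $S=(a_1,\dots,a_k)$ of non-negative integers, $\operatorname{size}(S)=\sum_i a_i$. Reduction Algorithm with parameter $m\geq 1$. The input is a sequence of positive integers $S=(b_1,\dots,b_p,a_1,\dots,a_m)$, so that $a_1,\dots,a_m$ are its last $m$ entries. Put $Z_m=\{1,2,\dots,m\}$. For $k=m,m-1,\dots,1$ in this order: let $z_k=\max Z_k$; put $r_k=a_k$ if $a_k<m$ and $a_k\leq z_k$, and $r_k=z_k$ otherwise; put $c_k=a_k-r_k$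 and $Z_{k-1}=Z_k\setminus\{r_k\}$; if $Z_{k-1}=Z_k$ (i.e. $r_k\notin Z_k$), the algorithm stops with failure. If the algorithm does not fail, $S$ is called $m$-reducible, and its $m$-reduction is $(b_1,\dots,b_p,c_1,\dots,c_m)$. If it fails, or if $S$ has fewer than $m$ entries, $S$ is not $m$-reducible. When reductions are performed consecutively, zeros at the end of a sequence are deleted before the next reduction is applied. *)

theory Defs
  imports "HOL-Analysis.Analysis" "HOL-Library.Poly_Mapping" "HOL-Library.Numeral_Type"
begin

section \<open>Multivariate polynomials over the complex numbers\<close>

text \<open>A monomial is its finitely supported exponent function, and a polynomial is the finitely
  supported function of its coefficients; multiplication is convolution.\<close>

type_synonym 'v mpoly = "('v \<Rightarrow>\<^sub>0 nat) \<Rightarrow>\<^sub>0 complex"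

definition mp_scale :: "complex \<Rightarrow> 'v mpoly \<Rightarrow> 'v mpoly" where
  "mp_scale c F = Poly_Mapping.single 0 c * F"

global_interpretation mpoly_space: vector_space mp_scale
  by unfold_locales
    (simp_all add: mp_scale_def distrib_left distrib_right single_add mult.assoc[symmetric]
      mult_single)

definition mp_eval :: "'v mpoly \<Rightarrow> ('v \<Rightarrow> complex) \<Rightarrow> complex" where
  "mp_eval F x =
     (\<Sum>a\<in>Poly_Mapping.keys F. Poly_Mapping.lookup F a *
        (\<Prod>v\<in>Poly_Mapping.keys a. x v ^ Poly_Mapping.lookup a v))"

text \<open>Where the exponent of \<open>v\<close> is 0, the (truncated) exponent subtraction is harmless, since the
  coefficient is 0.\<close>

definition mp_deriv :: "'v \<Rightarrow> 'v mpoly \<Rightarrow> 'v mpoly" where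
  "mp_deriv v F =
     (\<Sum>a\<in>Poly_Mapping.keys F.
        Poly_Mapping.single (a - Poly_Mapping.single v 1)
          (of_nat (Poly_Mapping.lookup a v) * Poly_Mapping.lookup F a))"


section \<open>The projective plane\<close>

definition same_point :: "complex ^ 3 \<Rightarrow> complex ^ 3 \<Rightarrow> bool" where
  "same_point v w \<longleftrightarrow> v \<noteq> 0 \<and> (\<exists>c. c \<noteq> 0 \<and> w = c *s v)"

lemma part_equivp_same_point: "part_equivp same_point"
proof (rule part_equivpI)
  have "same_point (1 :: complex ^ 3) 1"
    unfolding same_point_def by (auto intro!: exI[of _ 1])
  then show "\<exists>v. same_point v v" ..
  show "symp same_point"
  proof (rule sympI)
    fix v w :: "complex ^ 3"
    assume "same_point v w"
    then obtain c where "v \<noteq> 0" "c \<noteq> 0" "w = c *s v"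
      by (auto simp: same_point_def)
    then have "w \<noteq> 0" "v = inverse c *s w"
      by (auto simp: vector_smult_assoc)
    with \<open>c \<noteq> 0\<close> show "same_point w v"
      unfolding same_point_def by (auto intro!: exI[of _ "inverse c"])
  qed
  show "transp same_point"
  proof (rule transpI)
    fix u v w :: "complex ^ 3"
    assume "same_point u v" "same_point v w"
    then obtain c c' where "u \<noteq> 0" "c \<noteq> 0" "v = c *s u" "c' \<noteq> 0" "w = c' *s v"
      by (auto simp: same_point_def)
    then show "same_point u w"
      unfolding same_point_def by (auto intro!: exI[of _ "c' * c"] simp: vector_smult_assoc)
  qed
qed

quotient_type proj_plane = "complex ^ 3" / partial: same_point
  by (rule part_equivp_same_point)

text \<open>\<open>rep_proj_plane P\<close> is a vector of homogeneous coordinates of \<open>P\<close>. It is only used in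
  conditions on (multi)homogeneous polynomials that do not depend on the choice of
  coordinates.\<close>

text \<open>A point of the \<open>s\<close>-fold product of the plane is a list of length \<open>s\<close>. Its closed sets are cut
  out by polynomials in the variables \<open>(i, k)\<close>, the \<open>k\<close>-th coordinate of the \<open>i\<close>-th point, that are
  homogeneous in each of the \<open>s\<close> groups of variables.\<close>

definition multihomogeneous :: "nat \<Rightarrow> (nat \<times> 3) mpoly \<Rightarrow> bool" where
  "multihomogeneous s F \<longleftrightarrow>
     (\<forall>a\<in>Poly_Mapping.keys F. Poly_Mapping.keys a \<subseteq> {..<s} \<times> UNIV) \<and>
     (\<exists>e :: nat \<Rightarrow> nat. \<forall>a\<in>Poly_Mapping.keys F. \<forall>i<s.
        (\<Sum>k\<in>UNIV. Poly_Mapping.lookup a (i, k)) = e i)"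

definition coords :: "proj_plane list \<Rightarrow> nat \<times> 3 \<Rightarrow> complex" where
  "coords Ps = (\<lambda>(i, k). rep_proj_plane (Ps ! i) $ k)"

definition zariski_closed :: "nat \<Rightarrow> proj_plane list set \<Rightarrow> bool" where
  "zariski_closed s Z \<longleftrightarrow>
     (\<exists>\<F>. (\<forall>F\<in>\<F>. multihomogeneous s F) \<and>
        Z = {Ps. length Ps = s \<and> (\<forall>F\<in>\<F>. mp_eval F (coords Ps) = 0)})"

definition zariski_open :: "nat \<Rightarrow> proj_plane list set \<Rightarrow> bool" where
  "zariski_open s U \<longleftrightarrow>
     U \<subseteq> {Ps. length Ps = s} \<and> zariski_closed s ({Ps. length Ps = s} - U)"

definition for_general_points :: "nat \<Rightarrow> (proj_plane list \<Rightarrow> bool) \<Rightarrow> bool" where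
  "for_general_points s Q \<longleftrightarrow> (\<exists>U. zariski_open s U \<and> U \<noteq> {} \<and> (\<forall>Ps\<in>U. Q Ps))"


section \<open>Linear systems of plane curves\<close>

definition is_form :: "nat \<Rightarrow> 3 mpoly \<Rightarrow> bool" where
  "is_form d F \<longleftrightarrow>
     (\<forall>a\<in>Poly_Mapping.keys F. (\<Sum>k\<in>UNIV. Poly_Mapping.lookup a k) = d)"

text \<open>\<open>vs\<close> lists the variables with respect to which one differentiates successively.\<close>

definition vanishes_to_order :: "nat \<Rightarrow> proj_plane \<Rightarrow> 3 mpoly \<Rightarrow> bool" where
  "vanishes_to_order m P F \<longleftrightarrow>
     (\<forall>vs :: 3 list. length vs < m \<longrightarrow>
        mp_eval (foldr mp_deriv vs F) (($) (rep_proj_plane P)) = 0)"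

text \<open>The vector space of forms whose projectivization is the linear system; the zero form belongs
  to it but defines no curve.\<close>

definition lin_sys :: "nat \<Rightarrow> nat list \<Rightarrow> proj_plane list \<Rightarrow> 3 mpoly set" where
  "lin_sys d ms Ps =
     {F. is_form d F \<and> (\<forall>i<length ms. vanishes_to_order (ms ! i) (Ps ! i) F)}"

definition sys_dim :: "nat \<Rightarrow> nat list \<Rightarrow> proj_plane list \<Rightarrow> int" where
  "sys_dim d ms Ps = int (mpoly_space.dim (lin_sys d ms Ps)) - 1"

definition vdim :: "nat \<Rightarrow> nat list \<Rightarrow> int" where
  "vdim d ms = int ((d + 2) choose 2) - (\<Sum>m\<leftarrow>ms. int ((m + 1) choose 2)) - 1"

definition expdim :: "nat \<Rightarrow> nat list \<Rightarrow> int" where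
  "expdim d ms = max (vdim d ms) (- 1)"

definition non_special :: "nat \<Rightarrow> nat list \<Rightarrow> proj_plane list \<Rightarrow> bool" where
  "non_special d ms Ps \<longleftrightarrow> sys_dim d ms Ps = expdim d ms"

definition effective :: "nat \<Rightarrow> nat list \<Rightarrow> proj_plane list \<Rightarrow> bool" where
  "effective d ms Ps \<longleftrightarrow> (\<exists>F\<in>lin_sys d ms Ps. F \<noteq> 0)"

definition h1_regular :: "nat \<Rightarrow> nat list \<Rightarrow> proj_plane list \<Rightarrow> bool" where
  "h1_regular d ms Ps \<longleftrightarrow> non_special d ms Ps \<and> effective d ms Ps"


section \<open>The reduction algorithm\<close>

text \<open>\<open>reduce_rev m Z as\<close> runs the steps of the algorithm on the remaining entries
  \<open>as = [a\<^sub>k, a\<^sub>k\<^sub>-\<^sub>1, \<dots>, a\<^sub>1]\<close> (in the order in which they are processed), with \<open>Z = Z\<^sub>k\<close>, and returns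
  \<open>[c\<^sub>k, \<dots>, c\<^sub>1]\<close>, or \<open>None\<close> on failure. Until a failure \<open>Z\<^sub>k\<close> has \<open>k\<close> elements, so the maximum is
  only taken of nonempty sets.\<close>

fun reduce_rev :: "nat \<Rightarrow> nat set \<Rightarrow> nat list \<Rightarrow> nat list option" where
  "reduce_rev m Z [] = Some []"
| "reduce_rev m Z (a # as) =
     (let z = Max Z; r = (if a < m \<and> a \<le> z then a else z)
      in if r \<notin> Z then None
         else map_option (\<lambda>cs. (a - r) # cs) (reduce_rev m (Z - {r}) as))"

definition m_reduction :: "nat \<Rightarrow> nat list \<Rightarrow> nat list option" where
  "m_reduction m S =
     (if 1 \<le> m \<and> m \<le> length S \<and> (\<forall>a\<in>set S. 0 < a)
      then map_option (\<lambda>cs. take (length S - m) S @ rev cs)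
             (reduce_rev m {1..m} (rev (drop (length S - m) S)))
      else None)"

definition m_reducible :: "nat \<Rightarrow> nat list \<Rightarrow> bool" where
  "m_reducible m S \<longleftrightarrow> m_reduction m S \<noteq> None"

definition strip_zeros :: "nat list \<Rightarrow> nat list" where
  "strip_zeros S = rev (dropWhile (\<lambda>a. a = 0) (rev S))"

end

theory Submission
  imports Defs "Jordan_Normal_Form.Determinant"
begin

text \<open>Independence of the conditions is a Zariski open property, so it suffices to find points at
  which they are independent. Read \<open>S = (a\<^sub>1, a\<^sub>2, \<dots>)\<close> as a set of monomials, \<open>a\<^sub>k\<close> of them in the
  \<open>k\<close>-th column. Up to the torus action, the conditions of order \<open>m\<close> at a point of the torus evaluate
  polynomials of degree less than \<open>m\<close> at the exponents of the monomials. The exponents removed by an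
  \<open>m\<close>-reduction lie on \<open>m\<close> parallel lines containing \<open>1, \<dots>, m\<close> of them (in some order), so by Bezout
  they determine such a polynomial. Moreover its value at any remaining exponent is determined by
  the lexicographically larger removed exponents. Hence, when the point tends to infinity along a
  one-parameter subgroup with lexicographic weights, the linear system of an \<open>m\<close>-fold point
  degenerates to the span of the remaining monomials, on which one proceeds by induction.\<close>

section \<open>Linear algebra\<close>

text \<open>The rule for \<open>r\<close> is what a lexicographic degeneration requires. A column is
  either used up, and then no exponent of it survives, or it loses the largest number still
  available, and then every column further left loses fewer. So if an exponent survives in column
  \<open>k\<close>, all columns that lose at least as many exponents as column \<open>k\<close> lie
  at \<open>k\<close> or to its right. A polynomial that vanishes at the removed exponents larger
  than the surviving one thus meets the zero counts of Bezout's argument on all these lines; one of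
  the linear factors split off is that of column \<open>k\<close>, so it vanishes at the surviving
  exponent too.

  No limit of linear systems is formed. A relation between the conditions is excluded directly for
  one explicit large value of the parameter \<open>t\<close>, which depends on the points already
  placed; this is why the points are chosen in the order opposite to the reductions. The count fits
  because an \<open>m\<close>-reduction removes exactly as many monomials as an
  \<open>m\<close>-fold point imposes conditions, so the size left at the end is
  \<open>vdim + 1\<close>.\<close>

lemma dual_family_exists:
  fixes A :: "'r \<Rightarrow> 'e \<Rightarrow> 'a::field"
  assumes "finite R" "finite E"
    and "\<And>\<nu>. (\<And>e. e \<in> E \<Longrightarrow> (\<Sum>\<rho>\<in>R. \<nu> \<rho> * A \<rho> e) = 0) \<Longrightarrow> \<forall>\<rho>\<in>R. \<nu> \<rho> = 0"
  shows "\<exists>B. \<forall>\<rho>\<in>R. \<forall>\<sigma>\<in>R. (\<Sum>e\<in>E. B \<rho> e * A \<sigma> e) = (if \<rho> = \<sigma> then 1 else 0)"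
  using assms(1,3)
proof (induction R rule: finite_induct)
  case empty
  then show ?case by simp
next
  case (insert \<rho>0 R)
  have "\<forall>\<rho>\<in>R. \<nu> \<rho> = 0" if \<nu>: "\<And>e. e \<in> E \<Longrightarrow> (\<Sum>\<rho>\<in>R. \<nu> \<rho> * A \<rho> e) = 0" for \<nu>
  proof -
    have "\<forall>\<rho>\<in>insert \<rho>0 R. (if \<rho> = \<rho>0 then 0 else \<nu> \<rho>) = 0"
    proof (rule insert.prems)
      fix e assume "e \<in> E"
      have "(\<Sum>\<rho>\<in>R. (if \<rho> = \<rho>0 then 0 else \<nu> \<rho>) * A \<rho> e) = (\<Sum>\<rho>\<in>R. \<nu> \<rho> * A \<rho> e)"
        using insert.hyps by (intro sum.cong) auto
      then show "(\<Sum>\<rho>\<in>insert \<rho>0 R. (if \<rho> = \<rho>0 then 0 else \<nu> \<rho>) * A \<rho> e) = 0"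
        using insert.hyps \<nu>[OF \<open>e \<in> E\<close>] by simp
    qed
    then show ?thesis using insert.hyps by (metis insertCI)
  qed
  from insert.IH[OF this] obtain B where
    B: "\<And>\<rho> \<sigma>. \<rho> \<in> R \<Longrightarrow> \<sigma> \<in> R \<Longrightarrow> (\<Sum>e\<in>E. B \<rho> e * A \<sigma> e) = (if \<rho> = \<sigma> then 1 else 0)"
    by blast
  \<comment> \<open>Gram-Schmidt for the pairing: \<open>A'\<close> is the new row minus its
    component along the old ones. By independence it is nonzero at some \<open>e0\<close>;
    evaluation at \<open>e0\<close> after removal of that component, divided by
    \<open>A' e0\<close>, is the functional \<open>b\<close> dual to the new row.\<close>
  define \<kappa> where "\<kappa> \<sigma> = (\<Sum>e\<in>E. B \<sigma> e * A \<rho>0 e)" for \<sigma>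
  define A' where "A' e = A \<rho>0 e - (\<Sum>\<sigma>\<in>R. \<kappa> \<sigma> * A \<sigma> e)" for e
  have "\<exists>e0\<in>E. A' e0 \<noteq> 0"
  proof (rule ccontr)
    assume "\<not> ?thesis"
    then have z: "A' e = 0" if "e \<in> E" for e using that by auto
    have "\<forall>\<rho>\<in>insert \<rho>0 R. (if \<rho> = \<rho>0 then 1 else - \<kappa> \<rho>) = 0"
    proof (rule insert.prems)
      fix e assume "e \<in> E"
      have "(\<Sum>\<rho>\<in>R. (if \<rho> = \<rho>0 then 1 else - \<kappa> \<rho>) * A \<rho> e) = (\<Sum>\<rho>\<in>R. - (\<kappa> \<rho> * A \<rho> e))"
        using insert.hyps by (intro sum.cong) auto
      then show "(\<Sum>\<rho>\<in>insert \<rho>0 R. (if \<rho> = \<rho>0 then 1 else - \<kappa> \<rho>) * A \<rho> e) = 0"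
        using insert.hyps z[OF \<open>e \<in> E\<close>] by (simp add: A'_def sum_negf)
    qed
    then show False by simp
  qed
  then obtain e0 where e0: "e0 \<in> E" "A' e0 \<noteq> 0" by blast
  define b where "b e = ((if e = e0 then 1 else 0) - (\<Sum>\<sigma>\<in>R. A \<sigma> e0 * B \<sigma> e)) / A' e0" for e
  have b_gen: "(\<Sum>e\<in>E. b e * f e) = (f e0 - (\<Sum>\<sigma>\<in>R. A \<sigma> e0 * (\<Sum>e\<in>E. B \<sigma> e * f e))) / A' e0" for f
  proof -
    have "(\<Sum>e\<in>E. b e * f e) =
        (\<Sum>e\<in>E. ((if e = e0 then f e else 0) - (\<Sum>\<sigma>\<in>R. A \<sigma> e0 * (B \<sigma> e * f e)))) / A' e0"
      unfolding sum_divide_distrib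
      by (intro sum.cong) (auto simp: b_def left_diff_distrib sum_distrib_right mult.assoc)
    also have "(\<Sum>e\<in>E. ((if e = e0 then f e else 0) - (\<Sum>\<sigma>\<in>R. A \<sigma> e0 * (B \<sigma> e * f e))))
        = f e0 - (\<Sum>\<sigma>\<in>R. A \<sigma> e0 * (\<Sum>e\<in>E. B \<sigma> e * f e))"
      unfolding sum_subtractf sum_distrib_left using e0 assms(2)
      by (subst sum.swap) simp
    finally show ?thesis .
  qed
  have b_R: "(\<Sum>e\<in>E. b e * A \<tau> e) = 0" if "\<tau> \<in> R" for \<tau>
  proof -
    have "(\<Sum>\<sigma>\<in>R. A \<sigma> e0 * (\<Sum>e\<in>E. B \<sigma> e * A \<tau> e)) = (\<Sum>\<sigma>\<in>R. if \<sigma> = \<tau> then A \<sigma> e0 else 0)"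
      by (intro sum.cong) (auto simp: B that)
    then show ?thesis using that insert.hyps by (simp add: b_gen)
  qed
  have b_0: "(\<Sum>e\<in>E. b e * A \<rho>0 e) = 1"
    using e0 by (simp add: b_gen \<kappa>_def[symmetric] A'_def mult.commute[of "A _ e0"])
  define B' where "B' \<rho> e = (if \<rho> = \<rho>0 then b e else B \<rho> e - \<kappa> \<rho> * b e)" for \<rho> e
  have B'_sum: "(\<Sum>e\<in>E. B' \<rho> e * f e) =
      (if \<rho> = \<rho>0 then \<Sum>e\<in>E. b e * f e
       else (\<Sum>e\<in>E. B \<rho> e * f e) - \<kappa> \<rho> * (\<Sum>e\<in>E. b e * f e))" for \<rho> f
    by (simp add: B'_def left_diff_distrib sum_subtractf sum_distrib_left mult.assoc)
  show ?case
  proof (intro exI ballI)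
    fix \<rho> \<sigma> assume "\<rho> \<in> insert \<rho>0 R" "\<sigma> \<in> insert \<rho>0 R"
    then show "(\<Sum>e\<in>E. B' \<rho> e * A \<sigma> e) = (if \<rho> = \<sigma> then 1 else 0)"
      unfolding B'_sum using insert.hyps
      by (auto simp: b_0 b_R B \<kappa>_def[symmetric])
  qed
qed

text \<open>Induction on \<open>C\<close>: the induction hypothesis applies to the functions
  vanishing at \<open>c0\<close>, and one function with value 1 at \<open>c0\<close> fixes the
  remaining coefficient. The lemma turns the vanishing statements that Bezout provides into the
  linear dependences needed for the degeneration.\<close>

lemma eval_in_span_of_common_zeros:
  fixes W :: "('x \<Rightarrow> 'a::field) set"
  assumes "finite C"
    and "\<And>p q. p \<in> W \<Longrightarrow> q \<in> W \<Longrightarrow> (\<lambda>x. p x + q x) \<in> W"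
    and "\<And>p c. p \<in> W \<Longrightarrow> (\<lambda>x. c * p x) \<in> W"
    and "\<And>p. p \<in> W \<Longrightarrow> (\<forall>c\<in>C. p c = 0) \<Longrightarrow> p e = 0"
  shows "\<exists>l. \<forall>p\<in>W. p e = (\<Sum>c\<in>C. l c * p c)"
  using assms
proof (induction C arbitrary: W rule: finite_induct)
  case empty
  then show ?case by auto
next
  case (insert c0 C)
  define W' where "W' = {p\<in>W. p c0 = 0}"
  have "\<exists>l. \<forall>p\<in>W'. p e = (\<Sum>c\<in>C. l c * p c)"
    by (rule insert.IH) (use insert.prems in \<open>auto simp: W'_def\<close>)
  then obtain l where l: "\<And>p. p \<in> W' \<Longrightarrow> p e = (\<Sum>c\<in>C. l c * p c)" by blast
  show ?case
  proof (cases "\<forall>p\<in>W. p c0 = 0")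
    case True
    then have "\<forall>p\<in>W. p e = (\<Sum>c\<in>insert c0 C. l c * p c)"
      using insert.hyps by (auto simp: l W'_def)
    then show ?thesis by blast
  next
    case False
    then obtain q where q: "q \<in> W" "q c0 \<noteq> 0" by blast
    define p0 where "p0 x = inverse (q c0) * q x" for x
    have p0: "p0 \<in> W" "p0 c0 = 1" using q insert.prems(2)[of q "inverse (q c0)"] by (auto simp: p0_def[abs_def])
    define l' where "l' c = (if c = c0 then p0 e - (\<Sum>c\<in>C. l c * p0 c) else l c)" for c
    have "p e = (\<Sum>c\<in>insert c0 C. l' c * p c)" if "p \<in> W" for p
    proof -
      have "(\<lambda>x. p x + (- p c0) * p0 x) \<in> W'"
        using insert.prems(1)[OF that insert.prems(2)[OF p0(1)], of "- p c0"] p0(2)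
        by (simp add: W'_def)
      from l[OF this] have "p e = p c0 * p0 e + (\<Sum>c\<in>C. l c * p c) - p c0 * (\<Sum>c\<in>C. l c * p0 c)"
        by (simp add: algebra_simps sum.distrib sum_distrib_left sum_subtractf)
      moreover have "(\<Sum>c\<in>C. l' c * p c) = (\<Sum>c\<in>C. l c * p c)"
        using insert.hyps by (intro sum.cong) (auto simp: l'_def)
      ultimately show ?thesis
        using insert.hyps by (simp add: l'_def algebra_simps)
    qed
    then show ?thesis by blast
  qed
qed

text \<open>As \<open>t \<rightarrow> \<infinity>\<close>, the values of \<open>p\<close> on \<open>D\<close>, which are combinations of its values at points of larger weight,
  become negligible; so a relation between the rows \<open>p\<close> and \<open>A\<close> on \<open>C \<union> D\<close> restricts
  approximately to a relation between the rows \<open>A\<close> on \<open>D\<close>.\<close>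

lemma degeneration:
  fixes W :: "('e \<Rightarrow> complex) set" and w :: "'e \<Rightarrow> nat" and A :: "'r \<Rightarrow> 'e \<Rightarrow> complex"
  assumes fin: "finite C" "finite D" "finite R"
    and dep: "\<And>e. e \<in> D \<Longrightarrow> \<exists>l. \<forall>p\<in>W. p e = (\<Sum>c\<in>{c\<in>C. w e < w c}. l c * p c)"
    and indep: "\<And>\<nu>. (\<And>e. e \<in> D \<Longrightarrow> (\<Sum>\<rho>\<in>R. \<nu> \<rho> * A \<rho> e) = 0) \<Longrightarrow> \<forall>\<rho>\<in>R. \<nu> \<rho> = 0"
  shows "\<exists>t>0. \<forall>p\<in>W. \<forall>\<nu>.
    (\<forall>e\<in>C \<union> D. p e * complex_of_real t ^ w e + (\<Sum>\<rho>\<in>R. \<nu> \<rho> * A \<rho> e) = 0) \<longrightarrow>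
    (\<forall>c\<in>C. p c = 0) \<and> (\<forall>\<rho>\<in>R. \<nu> \<rho> = 0)"
proof -
  obtain B where B: "\<And>\<rho> \<sigma>. \<rho> \<in> R \<Longrightarrow> \<sigma> \<in> R \<Longrightarrow>
      (\<Sum>e\<in>D. B \<rho> e * A \<sigma> e) = (if \<rho> = \<sigma> then 1 else 0)"
    using dual_family_exists[of R D A, OF fin(3,2) indep] by auto
  obtain l where l: "\<And>e p. e \<in> D \<Longrightarrow> p \<in> W \<Longrightarrow> p e = (\<Sum>c\<in>{c\<in>C. w e < w c}. l e c * p c)"
    using dep by metis
  define M where "M c e = (\<Sum>\<rho>\<in>R. B \<rho> e * A \<rho> c)" for c e
  define L where "L = (\<Sum>e\<in>D. \<Sum>c\<in>C. cmod (l e c))"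
  define K where "K = (\<Sum>c\<in>C. \<Sum>e\<in>D. cmod (M c e))"
  have L0: "L \<ge> 0" and K0: "K \<ge> 0" by (auto simp: L_def K_def intro!: sum_nonneg)
  \<comment> \<open>\<open>K\<close> controls \<psi> on \<open>C\<close> by \<psi> on
    \<open>D\<close>, and \<open>L\<close> controls \<open>p\<close> on \<open>D\<close> by
    \<open>p\<close> on \<open>C\<close>. Going round once costs the factor \<open>L * K\<close> and
    gains a factor \<open>t\<close>, so any \<open>t\<close> above \<open>L * K\<close> forces
    \<psi> to vanish on \<open>D\<close>. The summand 1 also gives \<open>t \<ge> 1\<close>, for
    comparing powers.\<close>
  define t where "t = L * K + 1"
  have t1: "t \<ge> 1" "t > L * K" using L0 K0 by (auto simp: t_def)
  show ?thesis
  proof (intro exI[of _ t] conjI ballI allI impI)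
    show "0 < t" using t1 by simp
    fix p \<nu>
    assume p: "p \<in> W"
      and H: "\<forall>e\<in>C \<union> D. p e * complex_of_real t ^ w e + (\<Sum>\<rho>\<in>R. \<nu> \<rho> * A \<rho> e) = 0"
    define \<psi> where "\<psi> e = (\<Sum>\<rho>\<in>R. \<nu> \<rho> * A \<rho> e)" for e
    have \<psi>: "\<psi> e = - p e * complex_of_real t ^ w e" if "e \<in> C \<union> D" for e
      using H that by (simp add: \<psi>_def add_eq_0_iff)
    have \<nu>: "\<nu> \<rho> = (\<Sum>e\<in>D. B \<rho> e * \<psi> e)" if "\<rho> \<in> R" for \<rho>
    proof -
      have "(\<Sum>e\<in>D. B \<rho> e * \<psi> e) = (\<Sum>\<sigma>\<in>R. \<nu> \<sigma> * (\<Sum>e\<in>D. B \<rho> e * A \<sigma> e))"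
        unfolding \<psi>_def sum_distrib_left by (subst sum.swap) (simp add: mult_ac)
      also have "\<dots> = (\<Sum>\<sigma>\<in>R. if \<sigma> = \<rho> then \<nu> \<sigma> else 0)"
        using that by (intro sum.cong) (auto simp: B)
      finally show ?thesis using that fin by simp
    qed
    have \<psi>C: "\<psi> c = (\<Sum>e\<in>D. M c e * \<psi> e)" for c
    proof -
      have "\<psi> c = (\<Sum>\<rho>\<in>R. (\<Sum>e\<in>D. B \<rho> e * \<psi> e) * A \<rho> c)"
        unfolding \<psi>_def[of c] by (intro sum.cong) (auto simp: \<nu>)
      then show ?thesis
        unfolding M_def sum_distrib_right by (subst sum.swap) (simp add: mult_ac)
    qed
    define X where "X = (\<Sum>e\<in>D. cmod (\<psi> e))"
    have X0: "X \<ge> 0" by (auto simp: X_def intro!: sum_nonneg)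
    have le_X: "cmod (\<psi> e) \<le> X" if "e \<in> D" for e
      unfolding X_def using that fin by (intro member_le_sum) auto
    have "(\<Sum>c\<in>C. cmod (\<psi> c)) \<le> (\<Sum>c\<in>C. \<Sum>e\<in>D. cmod (M c e) * X)"
    proof (intro sum_mono)
      fix c assume "c \<in> C"
      have "cmod (\<psi> c) \<le> (\<Sum>e\<in>D. cmod (M c e * \<psi> e))" unfolding \<psi>C[of c] by (rule norm_sum)
      also have "\<dots> \<le> (\<Sum>e\<in>D. cmod (M c e) * X)"
        by (intro sum_mono) (auto simp: norm_mult intro!: mult_left_mono le_X)
      finally show "cmod (\<psi> c) \<le> (\<Sum>e\<in>D. cmod (M c e) * X)" .
    qed
    also have "\<dots> = K * X" by (simp add: K_def sum_distrib_right)
    finally have CX: "(\<Sum>c\<in>C. cmod (\<psi> c)) \<le> K * X" .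
    have le_C: "cmod (\<psi> c) \<le> K * X" if "c \<in> C" for c
      using member_le_sum[of c C "\<lambda>c. cmod (\<psi> c)"] that fin CX by force
    have step: "t * cmod (\<psi> e) \<le> (\<Sum>c\<in>C. cmod (l e c)) * (K * X)" if e: "e \<in> D" for e
    proof -
      \<comment> \<open>The weights are natural numbers, so \<open>w e < w c\<close> leaves room for
        one additional power of \<open>t\<close>; it becomes the factor on the left.\<close>
      have "t * cmod (\<psi> e) = cmod (\<Sum>c\<in>{c\<in>C. w e < w c}. l e c * p c) * t ^ Suc (w e)"
        using t1 e by (simp add: \<psi> l[OF e p] norm_mult norm_power)
      also have "\<dots> \<le> (\<Sum>c\<in>{c\<in>C. w e < w c}. cmod (l e c * p c)) * t ^ Suc (w e)"
        using t1 by (intro mult_right_mono norm_sum) auto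
      also have "\<dots> = (\<Sum>c\<in>{c\<in>C. w e < w c}. cmod (l e c) * (cmod (p c) * t ^ Suc (w e)))"
        by (simp only: sum_distrib_right norm_mult mult.assoc)
      also have "\<dots> \<le> (\<Sum>c\<in>{c\<in>C. w e < w c}. cmod (l e c) * (K * X))"
      proof (intro sum_mono mult_left_mono)
        fix c assume c: "c \<in> {c\<in>C. w e < w c}"
        then have "cmod (p c) * t ^ Suc (w e) \<le> cmod (p c) * t ^ w c"
          using t1 by (intro mult_left_mono power_increasing) auto
        also have "\<dots> = cmod (\<psi> c)" using t1 c by (simp add: \<psi> norm_mult norm_power)
        also have "\<dots> \<le> K * X" using c by (intro le_C) simp
        finally show "cmod (p c) * t ^ Suc (w e) \<le> K * X" .
      qed auto
      also have "\<dots> \<le> (\<Sum>c\<in>C. cmod (l e c) * (K * X))"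
        using fin K0 X0 by (intro sum_mono2) auto
      finally show ?thesis by (simp add: sum_distrib_right)
    qed
    have "t * X = (\<Sum>e\<in>D. t * cmod (\<psi> e))" by (simp add: X_def sum_distrib_left)
    also have "\<dots> \<le> (\<Sum>e\<in>D. (\<Sum>c\<in>C. cmod (l e c)) * (K * X))" by (intro sum_mono step)
    also have "\<dots> = L * (K * X)" by (simp only: L_def sum_distrib_right)
    finally have "t * X \<le> L * (K * X)" .
    then have "(t - L * K) * X \<le> 0" by (simp add: algebra_simps)
    then have "X = 0" using t1 X0 by (simp add: mult_le_0_iff)
    then have "\<psi> e = 0" if "e \<in> D" for e using le_X[OF that] by simp
    then show "\<nu> \<rho> = 0" if "\<rho> \<in> R" for \<rho> using \<nu>[OF that] by simp
    show "p c = 0" if "c \<in> C" for c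
    proof -
      have "\<psi> c = 0" using \<open>X = 0\<close> le_C[OF that] by simp
      then show ?thesis using t1 that by (simp add: \<psi>)
    qed
  qed
qed

text \<open>The dual vectors span a complement of the common kernel: subtracting from
  \<open>v\<close> the combination of the \<open>b \<rho>\<close> with coefficients
  \<open>\<phi> \<rho> v\<close> gives a vector of the kernel. So a basis of the kernel and the
  vectors \<open>b \<rho>\<close> together form a basis of \<open>V\<close>.\<close>

lemma (in vector_space) dim_common_kernel:
  assumes V: "subspace V" and Bs: "finite Bs" "independent Bs" "span Bs = V"
    and R: "finite R"
    and add: "\<And>\<rho> u v. \<rho> \<in> R \<Longrightarrow> u \<in> V \<Longrightarrow> v \<in> V \<Longrightarrow> \<phi> \<rho> (u + v) = \<phi> \<rho> u + \<phi> \<rho> v"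
    and scl: "\<And>\<rho> c v. \<rho> \<in> R \<Longrightarrow> v \<in> V \<Longrightarrow> \<phi> \<rho> (scale c v) = c * \<phi> \<rho> v"
    and b: "\<And>\<rho>. \<rho> \<in> R \<Longrightarrow> b \<rho> \<in> V"
    and dual: "\<And>\<rho> \<sigma>. \<rho> \<in> R \<Longrightarrow> \<sigma> \<in> R \<Longrightarrow> \<phi> \<sigma> (b \<rho>) = (if \<rho> = \<sigma> then 1 else 0)"
  shows "dim {v \<in> V. \<forall>\<rho>\<in>R. \<phi> \<rho> v = 0} + card R = card Bs"
proof -
  define K where "K = {v \<in> V. \<forall>\<rho>\<in>R. \<phi> \<rho> v = 0}"
  have phi0: "\<phi> \<rho> 0 = 0" if "\<rho> \<in> R" for \<rho>
    using scl[OF that subspace_0[OF V], of 0] by simp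
  have subK: "subspace K"
    using V unfolding K_def by (intro subspaceI) (auto simp: add scl phi0 subspace_0 subspace_add subspace_scale)
  have phisum: "\<phi> \<rho> (\<Sum>\<sigma>\<in>T. scale (c \<sigma>) (b \<sigma>)) = (\<Sum>\<sigma>\<in>T. c \<sigma> * \<phi> \<rho> (b \<sigma>))"
    if "\<rho> \<in> R" "T \<subseteq> R" for \<rho> c T
    using finite_subset[OF that(2) R] that(2)
  proof (induction T rule: finite_induct)
    case empty
    then show ?case using phi0 that by simp
  next
    case (insert x F)
    have "(\<Sum>\<sigma>\<in>F. scale (c \<sigma>) (b \<sigma>)) \<in> V" "scale (c x) (b x) \<in> V" "b x \<in> V"
      using V insert.prems b by (auto intro!: subspace_sum subspace_scale)
    then show ?case using insert that by (simp add: add scl)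
  qed
  have phic: "\<phi> \<rho> (\<Sum>\<sigma>\<in>R. scale (c \<sigma>) (b \<sigma>)) = c \<rho>" if "\<rho> \<in> R" for \<rho> c
  proof -
    have "\<phi> \<rho> (\<Sum>\<sigma>\<in>R. scale (c \<sigma>) (b \<sigma>)) = (\<Sum>\<sigma>\<in>R. if \<sigma> = \<rho> then c \<sigma> else 0)"
      using that by (subst phisum) (auto intro!: sum.cong simp: dual)
    then show ?thesis using that R by simp
  qed
  have injb: "inj_on b R" using dual by (intro inj_onI) (metis one_neq_zero)
  obtain BK where BK: "BK \<subseteq> K" "independent BK" "K \<subseteq> span BK" "card BK = dim K"
    using basis_exists by blast
  have finBK: "finite BK"
    using independent_span_bound[OF Bs(1) BK(2)] BK(1) Bs(3) by (auto simp: K_def)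
  have spanBK: "span BK = K" using BK subK by (simp add: span_minimal subset_antisym)
  have disj: "BK \<inter> b ` R = {}"
  proof -
    have "b \<rho> \<notin> K" if "\<rho> \<in> R" for \<rho> using dual[OF that that] that by (auto simp: K_def intro!: bexI[of _ \<rho>])
    then show ?thesis using BK(1) by auto
  qed
  have "independent (BK \<union> b ` R)"
  proof (rule independent_if_scalars_zero)
    show "finite (BK \<union> b ` R)" using finBK R by simp
    fix f x assume s: "(\<Sum>x\<in>BK \<union> b ` R. scale (f x) x) = 0" and x: "x \<in> BK \<union> b ` R"
    define u where "u = (\<Sum>x\<in>BK. scale (f x) x)"
    define v where "v = (\<Sum>\<rho>\<in>R. scale (f (b \<rho>)) (b \<rho>))"
    have uv: "u + v = 0"
      using s unfolding u_def v_def
      by (simp add: sum.union_disjoint[OF finBK finite_imageI[OF R] disj] sum.reindex[OF injb])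
    have uK: "u \<in> K" unfolding u_def using BK(1) subK by (auto intro!: subspace_sum subspace_scale)
    have vV: "v \<in> V" unfolding v_def using V b by (auto intro!: subspace_sum subspace_scale)
    have fb: "f (b \<rho>) = 0" if "\<rho> \<in> R" for \<rho>
    proof -
      have "\<phi> \<rho> (u + v) = f (b \<rho>)"
        using uK vV that by (simp add: add K_def) (simp add: v_def phic)
      then show ?thesis using uv phi0 that by simp
    qed
    then have "v = 0" by (simp add: v_def)
    then have "u = 0" using uv by simp
    then have "f x = 0" if "x \<in> BK"
      using independentD[OF BK(2) finBK subset_refl, of f x] that by (simp add: u_def)
    then show "f x = 0" using x fb by auto
  qed
  moreover have "span (BK \<union> b ` R) = V"
  proof
    show "span (BK \<union> b ` R) \<subseteq> V"
      using BK(1) b V by (intro span_minimal) (auto simp: K_def)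
    show "V \<subseteq> span (BK \<union> b ` R)"
    proof
      fix v assume v: "v \<in> V"
      define u where "u = (\<Sum>\<rho>\<in>R. scale (\<phi> \<rho> v) (b \<rho>))"
      have uV: "u \<in> V" unfolding u_def using V b by (auto intro!: subspace_sum subspace_scale)
      have nu: "scale (- 1) u \<in> V" using uV V by (rule subspace_scale[rotated])
      have "v + scale (- 1) u \<in> K"
        unfolding K_def mem_Collect_eq
      proof (intro conjI ballI)
        show "v + scale (- 1) u \<in> V" using v nu V by (intro subspace_add)
        show "\<phi> \<rho> (v + scale (- 1) u) = 0" if "\<rho> \<in> R" for \<rho>
          unfolding add[OF that v nu] scl[OF that uV] using phic[OF that] by (simp add: u_def)
      qed
      then have "v + scale (- 1) u \<in> span (BK \<union> b ` R)"
        using spanBK span_mono[of BK "BK \<union> b ` R"] by auto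
      moreover have "u \<in> span (BK \<union> b ` R)"
        unfolding u_def by (intro span_sum span_scale span_base) auto
      ultimately have "(v + scale (- 1) u) + u \<in> span (BK \<union> b ` R)" by (rule span_add)
      then show "v \<in> span (BK \<union> b ` R)" by simp
    qed
  qed
  ultimately have "card (BK \<union> b ` R) = card Bs"
    using Bs by (metis dim_eq_card)
  then show ?thesis
    using BK(4) card_Un_disjoint[OF finBK finite_imageI[OF R] disj] card_image[OF injb]
    by (simp add: K_def)
qed

section \<open>Polynomials of bounded degree on parallel lines\<close>

text \<open>Polynomial functions of total degree less than \<open>k\<close>, in Horner form with respect to \<open>x\<close>.\<close>

fun low_degree :: "nat \<Rightarrow> (complex \<Rightarrow> complex \<Rightarrow> complex) set" where
  "low_degree 0 = {\<lambda>x y. 0}"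
| "low_degree (Suc k) = {\<lambda>x y. poly h y + x * p x y | h p. degree h \<le> k \<and> p \<in> low_degree k}"

lemma low_degree_SucI:
  "degree h \<le> k \<Longrightarrow> p \<in> low_degree k \<Longrightarrow> (\<lambda>x y. poly h y + x * p x y) \<in> low_degree (Suc k)"
  by auto

lemma low_degree_SucE:
  assumes "p \<in> low_degree (Suc k)"
  obtains h q where "p = (\<lambda>x y. poly h y + x * q x y)" "degree h \<le> k" "q \<in> low_degree k"
  using assms by auto

lemma low_degree_add: "p \<in> low_degree k \<Longrightarrow> q \<in> low_degree k \<Longrightarrow> (\<lambda>x y. p x y + q x y) \<in> low_degree k"
proof (induction k arbitrary: p q)
  case (Suc k)
  then obtain h p' g q' where *: "p = (\<lambda>x y. poly h y + x * p' x y)" "degree h \<le> k" "p' \<in> low_degree k"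
    "q = (\<lambda>x y. poly g y + x * q' x y)" "degree g \<le> k" "q' \<in> low_degree k" by auto
  have "(\<lambda>x y. p x y + q x y) = (\<lambda>x y. poly (h + g) y + x * (p' x y + q' x y))"
    by (simp add: * algebra_simps)
  then show ?case using Suc.IH[OF *(3,6)] *(2,5) by (auto intro!: exI[of _ "h + g"] degree_add_le)
qed simp

lemma low_degree_scale: "p \<in> low_degree k \<Longrightarrow> (\<lambda>x y. c * p x y) \<in> low_degree k"
proof (induction k arbitrary: p)
  case (Suc k)
  then obtain h p' where *: "p = (\<lambda>x y. poly h y + x * p' x y)" "degree h \<le> k" "p' \<in> low_degree k"
    by auto
  have "(\<lambda>x y. c * p x y) = (\<lambda>x y. poly (Polynomial.smult c h) y + x * (c * p' x y))"
    by (simp add: * algebra_simps)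
  then show ?case using Suc.IH[OF *(3)] *(2) by (auto intro!: exI[of _ "Polynomial.smult c h"] order_trans[OF degree_smult_le])
qed simp

lemma low_degree_zero: "(\<lambda>x y. 0) \<in> low_degree k"
proof (induction k)
  case (Suc k)
  then show ?case by (auto intro!: exI[of _ 0] exI[of _ "\<lambda>x y. 0"])
qed simp

lemma low_degree_sum:
  "(\<And>i. i \<in> I \<Longrightarrow> p i \<in> low_degree k) \<Longrightarrow> (\<lambda>x y. \<Sum>i\<in>I. p i x y) \<in> low_degree k"
proof (induction I rule: infinite_finite_induct)
  case (insert i I)
  then show ?case using low_degree_add[of "p i" k "\<lambda>x y. \<Sum>i\<in>I. p i x y"] by simp
qed (simp_all add: low_degree_zero)

lemma low_degree_Suc: "p \<in> low_degree k \<Longrightarrow> p \<in> low_degree (Suc k)"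
proof (induction k arbitrary: p)
  case 0
  then show ?case using low_degree_zero[of 1] by simp
next
  case (Suc k)
  then obtain h p' where *: "p = (\<lambda>x y. poly h y + x * p' x y)" "degree h \<le> k" "p' \<in> low_degree k"
    by auto
  from low_degree_SucI[OF _ Suc.IH[OF *(3)], of h] show ?case using *(1,2) by simp
qed

lemma low_degree_poly: "degree h < k \<Longrightarrow> (\<lambda>x y. poly h y) \<in> low_degree k"
  by (cases k) (auto intro!: exI[of _ h] exI[of _ "\<lambda>x y. 0"] low_degree_zero)

lemma low_degree_times_x: "p \<in> low_degree k \<Longrightarrow> (\<lambda>x y. x * p x y) \<in> low_degree (Suc k)"
  by (auto intro!: exI[of _ 0] exI[of _ p])

lemma low_degree_times_linear: "p \<in> low_degree k \<Longrightarrow> (\<lambda>x y. (x - a) * p x y) \<in> low_degree (Suc k)"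
  using low_degree_add[OF low_degree_times_x low_degree_scale[OF low_degree_Suc], of p k p "- a"]
  by (simp add: algebra_simps del: low_degree.simps)

text \<open>Horner form singles out the line x = 0. Expanding about x = a instead separates the
  restriction \<open>h\<close> to the line x = a from a multiple of x - a, which allows division by
  an arbitrary line of the family.\<close>

lemma low_degree_shift:
  assumes "p \<in> low_degree (Suc k)"
  obtains h q where "degree h \<le> k" "q \<in> low_degree k" "p = (\<lambda>x y. poly h y + (x - a) * q x y)"
proof -
  have "\<exists>h q. degree h \<le> k \<and> q \<in> low_degree k \<and> p = (\<lambda>x y. poly h y + (x - a) * q x y)"
    using assms
  proof (induction k arbitrary: p)
    case 0
    then obtain h where "degree h = 0" "p = (\<lambda>x y. poly h y)" by auto
    then show ?case by (intro exI[of _ h] exI[of _ "\<lambda>x y. 0"]) auto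
  next
    case (Suc k)
    obtain h p' where *: "p = (\<lambda>x y. poly h y + x * p' x y)" "degree h \<le> Suc k"
      "p' \<in> low_degree (Suc k)" by (rule low_degree_SucE[OF Suc.prems])
    from Suc.IH[OF *(3)] obtain g q where q: "degree g \<le> k" "q \<in> low_degree k"
      "p' = (\<lambda>x y. poly g y + (x - a) * q x y)" by blast
    have "(\<lambda>x y. a * q x y + p' x y) \<in> low_degree (Suc k)"
      by (intro low_degree_add low_degree_scale low_degree_Suc q *)
    moreover have "degree (h + Polynomial.smult a g) \<le> Suc k"
      using *(2) q(1) by (intro degree_add_le order_trans[OF degree_smult_le]) auto
    moreover have "p = (\<lambda>x y. poly (h + Polynomial.smult a g) y + (x - a) * (a * q x y + p' x y))"
      by (simp add: * q algebra_simps)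
    ultimately show ?case by blast
  qed
  then show ?thesis using that by blast
qed

text \<open>On the line numbered \<open>m\<close> the restriction has degree less than
  \<open>m\<close> and at least \<open>m\<close> zeros, so it is zero and the linear factor of the
  line splits off. The degree bound and the number of zeros available on the next line both drop by
  one, so this continues down to line \<open>z\<close>. For \<open>z = 1\<close> the quotient lies
  in \<open>low_degree 0\<close>, hence \<open>p\<close> is zero.\<close>

lemma low_degree_divisible:
  assumes "p \<in> low_degree m" "1 \<le> z" "z \<le> Suc m"
    and "inj_on cx {z..m}"
    and "\<And>j. j \<in> {z..m} \<Longrightarrow> finite (B j) \<and> j \<le> card (B j)"
    and "\<And>j y. j \<in> {z..m} \<Longrightarrow> y \<in> B j \<Longrightarrow> p (cx j) y = 0"
  shows "\<exists>q\<in>low_degree (z - 1). p = (\<lambda>x y. (\<Prod>j=z..m. x - cx j) * q x y)"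
  using assms
proof (induction m arbitrary: p)
  case 0
  then show ?case by auto
next
  case (Suc m)
  show ?case
  proof (cases "z = Suc (Suc m)")
    case True
    then show ?thesis using Suc.prems(1) by (auto simp del: low_degree.simps)
  next
    case False
    then have z: "z \<le> Suc m" using Suc.prems by simp
    obtain h q where hq: "degree h \<le> m" "q \<in> low_degree m"
      "p = (\<lambda>x y. poly h y + (x - cx (Suc m)) * q x y)"
      using low_degree_shift[OF Suc.prems(1)] .
    have hB: "B (Suc m) \<subseteq> {y. poly h y = 0}"
    proof
      fix y assume "y \<in> B (Suc m)"
      then show "y \<in> {y. poly h y = 0}" using Suc.prems(6)[of "Suc m" y] z by (simp add: hq)
    qed
    have "h = 0"
    proof (rule ccontr)
      assume "h \<noteq> 0"
      then have "card (B (Suc m)) \<le> degree h"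
        using card_mono[OF poly_roots_finite hB] card_poly_roots_bound by (metis le_trans)
      then show False using hq(1) Suc.prems(5)[of "Suc m"] z by auto
    qed
    have q0: "q (cx j) y = 0" if "j \<in> {z..m}" "y \<in> B j" for j y
    proof -
      have "cx j \<noteq> cx (Suc m)"
        using inj_onD[OF Suc.prems(4), of j "Suc m"] that z by auto
      then show ?thesis using Suc.prems(6)[of j y] that by (simp add: hq \<open>h = 0\<close>)
    qed
    have "\<exists>q'\<in>low_degree (z - 1). q = (\<lambda>x y. (\<Prod>j=z..m. x - cx j) * q' x y)"
      by (rule Suc.IH)
        (use hq z Suc.prems(2,4,5) q0 in \<open>auto intro: inj_on_subset[OF Suc.prems(4)]\<close>)
    then show ?thesis using z by (auto simp: hq \<open>h = 0\<close> prod.nat_ivl_Suc' mult_ac)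
  qed
qed

text \<open>Falling factorials arise as the factors when a power is differentiated \<open>k\<close> times.\<close>

definition ff :: "complex \<Rightarrow> nat \<Rightarrow> complex" where
  "ff x k = (\<Prod>i<k. x - of_nat i)"

lemma ff_0 [simp]: "ff x 0 = 1"
  by (simp add: ff_def)

lemma ff_Suc: "ff x (Suc k) = ff x k * (x - of_nat k)"
  by (simp add: ff_def)

lemma ff_eq_0: "n < k \<Longrightarrow> ff (of_nat n) k = 0"
  by (auto simp: ff_def)

lemma ff_self: "ff (of_nat n) n \<noteq> 0"
  by (auto simp: ff_def)

lemma ff_product_low_degree: "a + b < m \<Longrightarrow> (\<lambda>x y. ff y a * ff x b) \<in> low_degree m"
proof (induction b arbitrary: m)
  case 0
  have "(\<lambda>y. ff y a) = poly (\<Prod>i<a. [:- of_nat i, 1:])" by (auto simp: ff_def poly_prod)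
  moreover have "degree (\<Prod>i<a. [:- of_nat i, 1 :: complex:]) \<le> a"
    by (rule order_trans[OF degree_prod_sum_le]) simp_all
  ultimately show ?case using 0 low_degree_poly[of "\<Prod>i<a. [:- of_nat i, 1:]" m]
    by (simp add: ff_def[of _ 0] fun_eq_iff)
next
  case (Suc b)
  then obtain m' where "m = Suc m'" "a + b < m'" by (cases m) auto
  then show ?case using low_degree_times_linear[OF Suc.IH[of m'], of "of_nat b"]
    by (simp add: ff_def mult_ac del: low_degree.simps)
qed

section \<open>Falling factorials and the conditions at one point\<close>

definition conds :: "nat \<Rightarrow> (nat \<times> nat) set" where
  "conds m = {(a, b). a + b < m}"

lemma finite_conds [simp]: "finite (conds m)"
  by (rule finite_subset[of _ "{..<m} \<times> {..<m}"]) (auto simp: conds_def)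

lemma card_conds: "card (conds m) = (m + 1) choose 2"
proof -
  have "conds m = (SIGMA a:{..<m}. {..<m - a})" by (auto simp: conds_def)
  then have "card (conds m) = (\<Sum>a<m. m - a)" by (simp add: card_SigmaI)
  also have "\<dots> = (\<Sum>a<m. Suc a)"
    by (rule sum.reindex_bij_witness[of _ "\<lambda>a. m - Suc a" "\<lambda>a. m - Suc a"]) auto
  also have "\<dots> = (m + 1) choose 2"
    by (induction m) (auto simp: numeral_2_eq_2)
  finally show ?thesis .
qed

text \<open>Newton interpolation on a triangle of lattice points: a product with indices
  \<open>a'\<close>, \<open>b'\<close> vanishes at \<open>(a, b)\<close> unless
  \<open>a' \<le> a\<close> and \<open>b' \<le> b\<close>. The system is therefore triangular with
  respect to \<open>a + b\<close>, with diagonal entries nonzero by \<open>ff_self\<close>.\<close>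

lemma ff_products_independent:
  assumes "\<And>a b. (a, b) \<in> conds m \<Longrightarrow> (\<Sum>(a',b')\<in>conds m. \<mu> (a',b') * (ff (of_nat a) a' * ff (of_nat b) b')) = 0"
    and "(a, b) \<in> conds m"
  shows "\<mu> (a, b) = 0"
  using assms(2)
proof (induction "a + b" arbitrary: a b rule: less_induct)
  case less
  have "\<mu> c * (ff (of_nat a) (fst c) * ff (of_nat b) (snd c)) = 0" if "c \<in> conds m" "c \<noteq> (a, b)" for c
  proof (cases "fst c \<le> a \<and> snd c \<le> b")
    case True
    then have "fst c + snd c < a + b" using that(2) by (cases c) auto
    then show ?thesis using less.hyps[of "fst c" "snd c"] that by simp
  qed (auto simp: ff_eq_0)
  then have "(\<Sum>c\<in>conds m - {(a, b)}. \<mu> c * (ff (of_nat a) (fst c) * ff (of_nat b) (snd c))) = 0"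
    by (intro sum.neutral) auto
  moreover have "(\<Sum>c\<in>conds m. \<mu> c * (ff (of_nat a) (fst c) * ff (of_nat b) (snd c))) = 0"
    using assms(1)[OF less.prems] by (simp add: case_prod_beta)
  ultimately have "\<mu> (a, b) * (ff (of_nat a) a * ff (of_nat b) b) = 0"
    using less.prems by (simp add: sum.remove)
  then show ?case by (simp add: ff_self)
qed

section \<open>The removed exponents\<close>

text \<open>Each step removes \<open>min a (Max Z)\<close> points, as many as a polynomial of degree less than \<open>m\<close>
  can still prescribe freely on that column; if the column is not exhausted, then every later
  removal is strictly smaller.\<close>

lemma reduce_rev_removed:
  assumes "reduce_rev m Z as = Some cs" "Z \<subseteq> {..m}" "card Z = length as"
  shows "\<exists>rs. length rs = length as \<and> distinct rs \<and> set rs = Z \<and>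
    (\<forall>i<length as. rs ! i \<le> as ! i) \<and>
    (\<forall>i j. i < j \<longrightarrow> j < length as \<longrightarrow> rs ! i < as ! i \<longrightarrow> rs ! j < rs ! i) \<and>
    cs = map2 (-) as rs"
  using assms
proof (induction as arbitrary: Z cs)
  case Nil
  then have "Z = {}" using finite_subset[OF Nil.prems(2)] by auto
  then show ?case using Nil by auto
next
  case (Cons a as)
  define r where "r = (if a < m \<and> a \<le> Max Z then a else Max Z)"
  have finZ: "finite Z" using finite_subset[OF Cons.prems(2)] by auto
  have "Z \<noteq> {}" using Cons.prems(3) by auto
  have rZ: "r \<in> Z" using Cons.prems(1) by (auto simp: Let_def r_def split: if_splits)
  then obtain cs' where cs': "reduce_rev m (Z - {r}) as = Some cs'" "cs = (a - r) # cs'"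
    using Cons.prems(1) by (auto simp: Let_def r_def)
  have "card (Z - {r}) = length as" using Cons.prems(3) rZ finZ by simp
  then obtain rs where rs: "length rs = length as" "distinct rs" "set rs = Z - {r}"
    "\<And>i. i < length as \<Longrightarrow> rs ! i \<le> as ! i"
    "\<And>i j. i < j \<Longrightarrow> j < length as \<Longrightarrow> rs ! i < as ! i \<Longrightarrow> rs ! j < rs ! i"
    "cs' = map2 (-) as rs"
    using Cons.IH[OF cs'(1) subset_trans[OF Diff_subset Cons.prems(2)]] by blast
  \<comment> \<open>For \<open>a \<ge> m\<close> the algorithm takes \<open>Max Z\<close>, and
    \<open>r \<le> a\<close> then rests on this bound.\<close>
  have "Max Z \<le> m" using Max_in[OF finZ \<open>Z \<noteq> {}\<close>] Cons.prems(2) by auto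
  have ra: "r \<le> a" using \<open>Max Z \<le> m\<close> by (auto simp: r_def)
  have less: "rs ! j < r" if "r < a" "j < length as" for j
  proof -
    have "r = Max Z" using that(1) by (auto simp: r_def split: if_splits)
    moreover have "rs ! j \<in> Z - {r}" using that(2) rs(1,3) nth_mem by metis
    ultimately show ?thesis using finZ by (metis DiffD1 DiffD2 Max_ge insertI1 order_le_imp_less_or_eq)
  qed
  show ?case
  proof (intro exI[of _ "r # rs"] conjI allI impI)
    show "length (r # rs) = length (a # as)" using rs by simp
    show "distinct (r # rs)" using rs by auto
    show "set (r # rs) = Z" using rs rZ by auto
    show "cs = map2 (-) (a # as) (r # rs)" using cs' rs by simp
    show "(r # rs) ! i \<le> (a # as) ! i" if "i < length (a # as)" for i
      using that ra rs(4) by (cases i) auto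
    show "(r # rs) ! j < (r # rs) ! i"
      if "i < j" "j < length (a # as)" "(r # rs) ! i < (a # as) ! i" for i j
      using that less rs(5) by (cases i; cases j) auto
  qed
qed

text \<open>The steps run from the last column to the left; here their record is indexed by columns,
  \<open>r k\<close> being the number of exponents taken from column \<open>k\<close>. What comes
  later in the algorithm is then further to the left, so a column that is not exhausted loses more
  than each of the last \<open>m\<close> columns to its left.\<close>

lemma m_reduction_removed:
  assumes "m_reduction m S = Some S'"
  obtains r where "inj_on r {length S - m..<length S}" "r ` {length S - m..<length S} = {1..m}"
    "\<And>k. k \<in> {length S - m..<length S} \<Longrightarrow> r k \<le> S ! k"
    "\<And>k l. length S - m \<le> l \<Longrightarrow> l < k \<Longrightarrow> k < length S \<Longrightarrow> r k < S ! k \<Longrightarrow> r l < r k"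
    "\<And>k. k < length S - m \<Longrightarrow> r k = 0"
    "\<And>k. k < length S \<Longrightarrow> S' ! k = S ! k - r k" "length S' = length S"
    "1 \<le> m" "m \<le> length S"
proof -
  let ?n = "length S"
  obtain cs where m: "1 \<le> m" "m \<le> ?n"
    and cs: "reduce_rev m {1..m} (rev (drop (?n - m) S)) = Some cs" "S' = take (?n - m) S @ rev cs"
    using assms by (auto simp: m_reduction_def split: if_splits)
  obtain rs where rs: "length rs = m" "distinct rs" "set rs = {1..m}"
    "\<And>i. i < m \<Longrightarrow> rs ! i \<le> rev (drop (?n - m) S) ! i"
    "\<And>i j. i < j \<Longrightarrow> j < m \<Longrightarrow> rs ! i < rev (drop (?n - m) S) ! i \<Longrightarrow> rs ! j < rs ! i"
    "cs = map2 (-) (rev (drop (?n - m) S)) rs"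
    using reduce_rev_removed[OF cs(1)] m by auto
  have nth: "rev (drop (?n - m) S) ! i = S ! (?n - Suc i)" if "i < m" for i
    using that m by (simp add: rev_nth)
  define r where "r k = (if k < ?n - m then 0 else rs ! (?n - Suc k))" for k
  have r: "r k = rs ! (?n - Suc k)" "?n - Suc k < m" "?n - Suc (?n - Suc k) = k"
    if "?n - m \<le> k" "k < ?n" for k
    using that m by (auto simp: r_def)
  show thesis
  proof (rule that)
    show "1 \<le> m" "m \<le> ?n" by fact+
    have len: "length cs = m" using rs(1,6) m by simp
    then show "length S' = ?n" using cs(2) m by simp
    show "inj_on r {?n - m..<?n}"
    proof (rule inj_onI)
      fix k l assume *: "k \<in> {?n - m..<?n}" "l \<in> {?n - m..<?n}" "r k = r l"
      then have "?n - Suc k = ?n - Suc l"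
        using r[of k] r[of l] rs(1,2) by (metis atLeastLessThan_iff nth_eq_iff_index_eq)
      then show "k = l" using * by auto
    qed
    show "r ` {?n - m..<?n} = {1..m}"
    proof -
      have "r ` {?n - m..<?n} = (\<lambda>i. rs ! i) ` {..<m}"
      proof (intro equalityI subsetI)
        fix x assume "x \<in> r ` {?n - m..<?n}"
        then show "x \<in> (\<lambda>i. rs ! i) ` {..<m}" using r by force
      next
        fix x assume "x \<in> (\<lambda>i. rs ! i) ` {..<m}"
        then obtain i where i: "i < m" "x = rs ! i" by auto
        then have "x = r (?n - Suc i)" using r(1)[of "?n - Suc i"] m by (simp add: Suc_diff_Suc)
        moreover have "?n - Suc i \<in> {?n - m..<?n}" using i m by auto
        ultimately show "x \<in> r ` {?n - m..<?n}" by blast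
      qed
      also have "\<dots> = set rs" using rs(1) by (auto simp: in_set_conv_nth)
      finally show ?thesis using rs(3) by simp
    qed
    show "r k \<le> S ! k" if "k \<in> {?n - m..<?n}" for k
      using rs(4)[of "?n - Suc k"] r[of k] nth[of "?n - Suc k"] that by auto
    show "r l < r k" if "?n - m \<le> l" "l < k" "k < ?n" "r k < S ! k" for k l
    proof -
      have "?n - Suc k < ?n - Suc l" using that by arith
      then show ?thesis
        using rs(5)[of "?n - Suc k" "?n - Suc l"] r[of k] r[of l] nth[of "?n - Suc k"] that by auto
    qed
    show "r k = 0" if "k < ?n - m" for k using that by (simp add: r_def)
    show "S' ! k = S ! k - r k" if "k < ?n" for k
    proof (cases "k < ?n - m")
      case True
      then show ?thesis using cs(2) by (simp add: nth_append r_def)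
    next
      case False
      then have "S' ! k = rev cs ! (k - (?n - m))" using cs(2) by (simp add: nth_append)
      also have "\<dots> = cs ! (m - Suc (k - (?n - m)))"
        using False that m len by (intro rev_nth[THEN trans]) auto
      also have "m - Suc (k - (?n - m)) = ?n - Suc k" using False that m by arith
      also have "cs ! (?n - Suc k) = S ! k - r k"
        using rs(1,6) r[of k] nth[of "?n - Suc k"] False that m by simp
      finally show ?thesis .
    qed
  qed
qed

text \<open>Columns are counted from 0, so the starting sequence becomes the triangle of all
  \<open>(k, b)\<close> with \<open>b \<le> k \<le> d\<close>, one pair for each monomial of degree
  \<open>d\<close>.\<close>

definition diagram :: "nat list \<Rightarrow> (nat \<times> nat) set" where
  "diagram S = {(k, b). k < length S \<and> b < S ! k}"

lemma diagram_Sigma: "diagram S = (SIGMA k:{..<length S}. {..<S ! k})"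
  by (auto simp: diagram_def)

lemma finite_diagram [simp]: "finite (diagram S)"
  by (simp add: diagram_Sigma)

lemma card_diagram: "card (diagram S) = sum_list S"
  by (simp add: diagram_Sigma sum_list_sum_nth atLeast0LessThan)

lemma diagram_strip_zeros: "diagram (strip_zeros S) = diagram S"
proof -
  have *: "\<exists>n. S = strip_zeros S @ replicate n 0"
  proof -
    have "S = rev (dropWhile (\<lambda>a. a = 0) (rev S)) @ rev (takeWhile (\<lambda>a. a = 0) (rev S))"
      by (metis rev_append rev_rev_ident takeWhile_dropWhile_id)
    moreover have "rev (takeWhile (\<lambda>a. a = 0) (rev S)) =
        replicate (length (takeWhile (\<lambda>a. a = 0) (rev S))) 0"
      by (metis (mono_tags, lifting) length_rev replicate_length_same set_rev set_takeWhileD)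
    ultimately show ?thesis by (auto simp: strip_zeros_def)
  qed
  then obtain n where "S = strip_zeros S @ replicate n 0" by blast
  then have "diagram S = diagram (strip_zeros S @ replicate n 0)" by simp
  also have "\<dots> = diagram (strip_zeros S)" by (auto simp: diagram_def nth_append split: if_splits)
  finally show ?thesis ..
qed

section \<open>Degeneration of the points\<close>

text \<open>The pair \<open>(k, h)\<close> stands for the monomial \<open>X\<^sub>1\<^sup>h X\<^sub>2\<^sup>k\<^sup>-\<^sup>h X\<^sub>3\<^sup>d\<^sup>-\<^sup>k\<close>, and \<open>(a, b)\<close> for differentiating \<open>a\<close> times
  by \<open>X\<^sub>1\<close> and \<open>b\<close> times by \<open>X\<^sub>3\<close>: by Euler's relation, derivatives by \<open>X\<^sub>2\<close> are redundant at points
  with \<open>x 2 \<noteq> 0\<close>.\<close>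

definition cond_coeff :: "nat \<Rightarrow> (3 \<Rightarrow> complex) \<Rightarrow> nat \<times> nat \<Rightarrow> nat \<times> nat \<Rightarrow> complex" where
  "cond_coeff d x = (\<lambda>(a, b) (k, h). ff (of_nat h) a * ff (of_nat (d - k)) b *
     (x 1 ^ (h - a) * x 2 ^ (k - h) * x 3 ^ (d - k - b)))"

text \<open>The coefficient splits into a factor for the monomial, a factor for the condition, and a
  polynomial in the exponents. After scaling rows and columns, combinations of the conditions are
  thus values of polynomials of degree less than \<open>m\<close>. Truncated exponents occur only
  where a falling factorial is 0.\<close>

lemma cond_coeff_torus:
  assumes "x 1 \<noteq> 0" "x 3 \<noteq> 0"
  shows "cond_coeff d x (a, b) (k, h) =
    (x 1 ^ h * x 2 ^ (k - h) * x 3 ^ (d - k)) / (x 1 ^ a * x 3 ^ b) *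
    (ff (of_nat h) a * ff (of_nat (d - k)) b)"
proof (cases "a \<le> h \<and> b \<le> d - k")
  case True
  then have "x 1 ^ (h - a) = x 1 ^ h / x 1 ^ a" "x 3 ^ (d - k - b) = x 3 ^ (d - k) / x 3 ^ b"
    using assms power_diff[of "x 1" a h] power_diff[of "x 3" b "d - k"] by auto
  then show ?thesis by (simp add: cond_coeff_def)
next
  case False
  then have "ff (of_nat h) a * ff (of_nat (d - k)) b = 0"
    using ff_eq_0[of h a] ff_eq_0[of "d - k" b] by force
  then show ?thesis by (auto simp: cond_coeff_def)
qed

lemma rep_abs_proj_plane:
  assumes "v \<noteq> 0"
  obtains s where "s \<noteq> 0" "rep_proj_plane (abs_proj_plane v) = s *s v"
proof -
  have "same_point v v" using assms by (auto simp: same_point_def intro!: exI[of _ 1])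
  then have "same_point v (rep_proj_plane (abs_proj_plane v))"
    using Quotient3_rep_abs[OF Quotient3_proj_plane] part_equivp_symp[OF part_equivp_same_point]
    by metis
  then show thesis using that by (auto simp: same_point_def)
qed

text \<open>The inductive step, run against the reductions: \<open>A\<close> holds the conditions at
  the points already chosen, independent on the surviving monomials, and the new point is moved so
  far out that its conditions and \<open>A\<close> are jointly independent on the whole diagram. The
  nonzero second coordinate is kept for Euler's relation.\<close>

lemma exists_torus_point:
  fixes A :: "'r \<Rightarrow> nat \<times> nat \<Rightarrow> complex"
  assumes red: "m_reduction m S = Some S'"
    and tri: "diagram S \<subseteq> {(k, h). h \<le> k \<and> k \<le> d}"
    and R: "finite R"
    and indep: "\<And>\<nu>. (\<And>e. e \<in> diagram S' \<Longrightarrow> (\<Sum>\<rho>\<in>R. \<nu> \<rho> * A \<rho> e) = 0) \<Longrightarrow> \<forall>\<rho>\<in>R. \<nu> \<rho> = 0"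
  shows "\<exists>P. rep_proj_plane P $ 2 \<noteq> 0 \<and> (\<forall>\<mu> \<nu>.
    (\<forall>e\<in>diagram S. (\<Sum>c\<in>conds m. \<mu> c * cond_coeff d (($) (rep_proj_plane P)) c e) +
       (\<Sum>\<rho>\<in>R. \<nu> \<rho> * A \<rho> e) = 0) \<longrightarrow>
    (\<forall>c\<in>conds m. \<mu> c = 0) \<and> (\<forall>\<rho>\<in>R. \<nu> \<rho> = 0))"
proof -
  obtain r where r: "inj_on r {length S - m..<length S}"
    "r ` {length S - m..<length S} = {1..m}"
    "\<And>k. k \<in> {length S - m..<length S} \<Longrightarrow> r k \<le> S ! k"
    "\<And>k l. length S - m \<le> l \<Longrightarrow> l < k \<Longrightarrow> k < length S \<Longrightarrow> r k < S ! k \<Longrightarrow> r l < r k"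
    "\<And>k. k < length S - m \<Longrightarrow> r k = 0"
    "\<And>k. k < length S \<Longrightarrow> S' ! k = S ! k - r k" "length S' = length S"
    "1 \<le> m" "m \<le> length S"
    using m_reduction_removed[OF red] by metis
  define I where "I = {length S - m..<length S}"
  \<comment> \<open>\<open>g j\<close> is the column that loses exactly \<open>j\<close>
    exponents.\<close>
  define g where "g = inv_into I r"
  have g: "g j \<in> I" "r (g j) = j" if "j \<in> {1..m}" for j
    using that r(2) unfolding g_def I_def by (metis inv_into_into, metis f_inv_into_f)
  have gr: "g (r k) = k" if "k \<in> I" for k
    using that r(1) unfolding g_def I_def by simp
  have Id: "k \<le> d" if "k \<in> I" for k
  proof -
    have "r k \<in> {1..m}" using that r(2) unfolding I_def by blast
    then have "(k, 0) \<in> diagram S" using r(3)[of k] that by (auto simp: diagram_def I_def)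
    then show ?thesis using tri by auto
  qed
  \<comment> \<open>With x = d - k and y = h the columns become the parallel lines of Bezout's
    argument. Zeros at the exponents removed from the columns that lose at least \<open>z\<close>
    suffice to split off the factors of these columns.\<close>
  have divis: "\<exists>q'\<in>low_degree (z - 1).
      q = (\<lambda>x y. (\<Prod>j=z..m. x - of_nat (d - g j)) * q' x y)"
    if q: "q \<in> low_degree m" and z: "1 \<le> z" "z \<le> m"
      and zero: "\<And>l h. l \<in> I \<Longrightarrow> z \<le> r l \<Longrightarrow> S ! l - r l \<le> h \<Longrightarrow> h < S ! l \<Longrightarrow>
        q (of_nat (d - l)) (of_nat h) = 0" for q z
  proof (rule low_degree_divisible[OF q z(1)])
    show "z \<le> Suc m" using z by simp
    show "inj_on (\<lambda>j. of_nat (d - g j) :: complex) {z..m}"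
    proof (rule inj_onI)
      fix i j assume *: "i \<in> {z..m}" "j \<in> {z..m}" "(of_nat (d - g i) :: complex) = of_nat (d - g j)"
      then have "i \<in> {1..m}" "j \<in> {1..m}" using z by auto
      moreover from this have "g i = g j" using *(3) Id g(1)
        by (metis diff_diff_cancel of_nat_eq_iff)
      ultimately show "i = j" using g(2) by metis
    qed
    fix j assume j: "j \<in> {z..m}"
    then have j1: "j \<in> {1..m}" using z by auto
    have "j \<le> S ! g j" using g[OF j1] r(3)[of "g j"] by (simp add: I_def)
    then show "finite (of_nat ` {S ! g j - j..<S ! g j} :: complex set) \<and>
        j \<le> card (of_nat ` {S ! g j - j..<S ! g j} :: complex set)"
      by (simp add: card_image inj_on_def)
    fix y :: complex assume "y \<in> of_nat ` {S ! g j - j..<S ! g j}"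
    then show "q (of_nat (d - g j)) y = 0"
      using zero[OF g(1)[OF j1]] g(2)[OF j1] j by auto
  qed
  \<comment> \<open>Each column loses its top exponents, so survivors are lighter than the removed
    exponents of the same column.\<close>
  define C where "C = {(k, h). k < length S \<and> S ! k - r k \<le> h \<and> h < S ! k}"
  have CI: "k \<in> I" if "(k, h) \<in> C" for k h
    using that r(5)[of k] by (cases "k < length S - m") (auto simp: C_def I_def)
  have ID: "C \<union> diagram S' = diagram S"
    using r(6,7) by (auto simp: C_def diagram_def)
  have finC: "finite C" using ID finite_diagram[of S] by (metis finite_Un)
  define W where "W = (\<lambda>q (k, h). q (of_nat (d - k)) (of_nat h) :: complex) ` low_degree m"
  \<comment> \<open>Larger than every height \<open>h\<close> that occurs, so \<open>w\<close> is
    lexicographic: first by column, then by height.\<close>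
  define N where "N = Suc d"
  define w where "w = (\<lambda>(k, h). N * k + h)"
  have zero: "q = (\<lambda>x y. 0)"
    if q: "q \<in> low_degree m" "\<And>k h. (k, h) \<in> C \<Longrightarrow> q (of_nat (d - k)) (of_nat h) = 0" for q
    using divis[OF q(1), of 1] q(2) r(8) by (auto simp: C_def I_def)
  have "\<exists>t>0. \<forall>p\<in>W. \<forall>\<nu>.
    (\<forall>e\<in>C \<union> diagram S'. p e * complex_of_real t ^ w e + (\<Sum>\<rho>\<in>R. \<nu> \<rho> * A \<rho> e) = 0) \<longrightarrow>
    (\<forall>c\<in>C. p c = 0) \<and> (\<forall>\<rho>\<in>R. \<nu> \<rho> = 0)"
  proof (rule degeneration[OF finC finite_diagram R])
    show "\<forall>\<rho>\<in>R. \<nu> \<rho> = 0"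
      if "\<And>e. e \<in> diagram S' \<Longrightarrow> (\<Sum>\<rho>\<in>R. \<nu> \<rho> * A \<rho> e) = 0" for \<nu>
      using indep that by blast
    fix e assume e: "e \<in> diagram S'"
    obtain k h where kh: "e = (k, h)" by (cases e)
    have eS: "k < length S" "h < S ! k - r k" using e kh r(6,7) by (auto simp: diagram_def)
    have "(k, h) \<in> diagram S" using eS by (auto simp: diagram_def)
    then have hk: "h \<le> k" "k \<le> d" using tri by auto
    have heavy: "w e < w (l, h')" if "k < l" for l h'
    proof -
      have "N * k + h < N * Suc k" using hk by (simp add: N_def)
      also have "\<dots> \<le> N * l" using that by (intro mult_le_mono2) simp
      finally show ?thesis by (simp add: w_def kh)
    qed
    show "\<exists>l. \<forall>p\<in>W. p e = (\<Sum>c\<in>{c\<in>C. w e < w c}. l c * p c)"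
    proof (rule eval_in_span_of_common_zeros)
      show "finite {c \<in> C. w e < w c}" using finC by simp
      show "(\<lambda>x. p x + q x) \<in> W" if "p \<in> W" "q \<in> W" for p q
        using that low_degree_add unfolding W_def by (force simp: image_iff fun_eq_iff)
      show "(\<lambda>x. c * p x) \<in> W" if "p \<in> W" for p c
        using that low_degree_scale unfolding W_def by (force simp: image_iff fun_eq_iff)
      fix p assume "p \<in> W" and p: "\<forall>c\<in>{c \<in> C. w e < w c}. p c = 0"
      then obtain q where q: "q \<in> low_degree m"
        "p = (\<lambda>(k, h). q (of_nat (d - k)) (of_nat h))" by (auto simp: W_def)
      show "p e = 0"
      proof (cases "k < length S - m")
        case True
        \<comment> \<open>An untouched column lies to the left of all removed exponents, so
          \<open>q\<close> vanishes at every one of them.\<close>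
        have "q = (\<lambda>x y. 0)"
        proof (rule zero[OF q(1)])
          fix l h' assume l: "(l, h') \<in> C"
          then have "k < l" using CI[OF l] True by (simp add: I_def)
          then show "q (of_nat (d - l)) (of_nat h') = 0" using p l heavy by (auto simp: q(2))
        qed
        then show ?thesis by (simp add: q(2) kh)
      next
        case False
        then have kI: "k \<in> I" using eS by (simp add: I_def)
        then have rk: "r k \<in> {1..m}" using r(2) unfolding I_def by blast
        \<comment> \<open>Column \<open>k\<close> keeps \<open>e\<close>, so
          \<open>r k < S ! k\<close>: columns losing at least \<open>r k\<close> exponents are
          \<open>k\<close> or to its right, and their removed exponents are heavier than
          \<open>e\<close>. The factor with \<open>j = r k\<close> vanishes on column
          \<open>k\<close>.\<close>
        have "\<exists>q'\<in>low_degree (r k - 1).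
            q = (\<lambda>x y. (\<Prod>j=r k..m. x - of_nat (d - g j)) * q' x y)"
        proof (rule divis[OF q(1)])
          fix l h' assume l: "l \<in> I" "r k \<le> r l" "S ! l - r l \<le> h'" "h' < S ! l"
          have "(l, h') \<in> C" using l by (auto simp: C_def I_def)
          moreover have "w e < w (l, h')"
          proof (cases "l = k")
            case True
            then show ?thesis using l eS by (simp add: w_def kh)
          next
            case False
            then have "k < l" using r(4)[of l k] l kI eS by (force simp: I_def)
            then show ?thesis by (rule heavy)
          qed
          ultimately show "q (of_nat (d - l)) (of_nat h') = 0" using p by (auto simp: q(2))
        qed (use rk in auto)
        then obtain q' where "q = (\<lambda>x y. (\<Prod>j=r k..m. x - of_nat (d - g j)) * q' x y)" by blast
        moreover have "(\<Prod>j=r k..m. of_nat (d - k) - of_nat (d - g j) :: complex) = 0"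
          using rk gr[OF kI] by (intro prod_zero) (auto intro!: bexI[of _ "r k"])
        ultimately show ?thesis by (simp add: q(2) kh)
      qed
    qed
  qed
  then obtain t where t: "t > 0"
    and deg: "\<And>p \<nu>. p \<in> W \<Longrightarrow>
      (\<And>e. e \<in> diagram S \<Longrightarrow> p e * complex_of_real t ^ w e + (\<Sum>\<rho>\<in>R. \<nu> \<rho> * A \<rho> e) = 0) \<Longrightarrow>
      (\<forall>c\<in>C. p c = 0) \<and> (\<forall>\<rho>\<in>R. \<nu> \<rho> = 0)"
    unfolding ID by blast
  \<comment> \<open>Weights N + 1, N and 0 of the coordinates give the monomial of
    \<open>(k, h)\<close> the weight (N + 1) h + N (k - h) = N k + h, which is
    \<open>w (k, h)\<close>.\<close>
  define v :: "complex ^ 3" where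
    "v = vector [of_real t ^ Suc N, of_real t ^ N, 1]"
  have v: "v $ 1 = of_real t ^ Suc N" "v $ 2 = of_real t ^ N" "v $ 3 = 1"
    by (simp_all add: v_def)
  have "v $ 3 \<noteq> 0" by (simp add: v)
  then have "v \<noteq> 0" by auto
  then obtain s where s: "s \<noteq> 0" "rep_proj_plane (abs_proj_plane v) = s *s v"
    by (rule rep_abs_proj_plane)
  define x where "x = (($) (rep_proj_plane (abs_proj_plane v)))"
  have x: "x 1 = s * of_real t ^ Suc N" "x 2 = s * of_real t ^ N" "x 3 = s"
    unfolding x_def s(2) by (simp_all add: v)
  have x0: "x 1 \<noteq> 0" "x 2 \<noteq> 0" "x 3 \<noteq> 0" using s(1) t by (simp_all add: x)
  have mono: "x 1 ^ h * x 2 ^ (k - h) * x 3 ^ (d - k) = s ^ d * of_real t ^ w (k, h)"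
    if "h \<le> k" "k \<le> d" for k h
  proof -
    have "x 1 ^ h * x 2 ^ (k - h) * x 3 ^ (d - k) =
        s ^ (h + (k - h) + (d - k)) * of_real t ^ (Suc N * h + N * (k - h))"
      unfolding x power_mult_distrib power_add power_mult by (simp only: mult_ac)
    moreover have "h + (k - h) + (d - k) = d" using that by simp
    moreover have "Suc N * h + N * (k - h) = w (k, h)"
      using that by (simp add: w_def) (metis add_mult_distrib2 le_add_diff_inverse)
    ultimately show ?thesis by simp
  qed
  show ?thesis
  proof (intro exI[of _ "abs_proj_plane v"] conjI allI impI)
    show "rep_proj_plane (abs_proj_plane v) $ 2 \<noteq> 0" using x0(2) by (simp add: x_def)
    fix \<mu> \<nu>
    assume H: "\<forall>e\<in>diagram S. (\<Sum>c\<in>conds m. \<mu> c *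
        cond_coeff d (($) (rep_proj_plane (abs_proj_plane v))) c e) + (\<Sum>\<rho>\<in>R. \<nu> \<rho> * A \<rho> e) = 0"
    \<comment> \<open>Absorbs the factors of the conditions and the power of the unknown scalar
      \<open>s\<close> between \<open>v\<close> and the chosen representative. What remains at
      \<open>e\<close> is a value of \<open>q\<close> times \<open>t ^ w e\<close>.\<close>
    define \<mu>' where "\<mu>' c = \<mu> c * (s ^ d / (x 1 ^ fst c * x 3 ^ snd c))" for c
    define q where "q = (\<lambda>x y. \<Sum>c\<in>conds m. \<mu>' c * (ff y (fst c) * ff x (snd c)))"
    have q: "q \<in> low_degree m"
      unfolding q_def
      by (intro low_degree_sum low_degree_scale ff_product_low_degree) (auto simp: conds_def)
    define p where "p = (\<lambda>(k, h). q (of_nat (d - k)) (of_nat h))"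
    have pW: "p \<in> W" using q by (auto simp: W_def p_def)
    have "p e * complex_of_real t ^ w e + (\<Sum>\<rho>\<in>R. \<nu> \<rho> * A \<rho> e) = 0" if e: "e \<in> diagram S" for e
    proof -
      obtain k h where kh: "e = (k, h)" by (cases e)
      have hk: "h \<le> k" "k \<le> d" using tri e kh by auto
      have "(\<Sum>c\<in>conds m. \<mu> c * cond_coeff d x c e) = p e * complex_of_real t ^ w e"
        unfolding p_def q_def kh prod.case sum_distrib_right
      proof (intro sum.cong refl)
        fix c assume "c \<in> conds m"
        obtain a b where c: "c = (a, b)" by (cases c)
        show "\<mu> c * cond_coeff d x c (k, h) =
            \<mu>' c * (ff (of_nat h) (fst c) * ff (of_nat (d - k)) (snd c)) * complex_of_real t ^ w (k, h)"
          unfolding c cond_coeff_torus[of x, OF x0(1,3)] mono[OF hk] by (simp add: \<mu>'_def)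
      qed
      then show ?thesis using bspec[OF H e] by (simp only: x_def)
    qed
    from deg[OF pW this] have C0: "\<forall>c\<in>C. p c = 0" and \<nu>: "\<forall>\<rho>\<in>R. \<nu> \<rho> = 0" by auto
    show "\<forall>\<rho>\<in>R. \<nu> \<rho> = 0" by fact
    have "q = (\<lambda>x y. 0)" using C0 by (intro zero[OF q]) (auto simp: p_def)
    then have q0: "(\<Sum>c\<in>conds m. \<mu>' c * (ff z (fst c) * ff y (snd c))) = 0" for y z
      unfolding q_def by metis
    have "\<mu>' (a, b) = 0" if "(a, b) \<in> conds m" for a b
      by (rule ff_products_independent[OF _ that]) (use q0 in \<open>simp add: case_prod_beta\<close>)
    then show "\<forall>c\<in>conds m. \<mu> c = 0" using x0 s(1) by (force simp: \<mu>'_def)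
  qed
qed

section \<open>Conditions at several points and chains of reductions\<close>

definition rows :: "nat list \<Rightarrow> (nat \<times> nat \<times> nat) set" where
  "rows ms = (SIGMA j:{..<length ms}. conds (ms ! j))"

lemma finite_rows [simp]: "finite (rows ms)"
  by (simp add: rows_def)

lemma sum_rows_Cons:
  fixes f :: "nat \<times> nat \<times> nat \<Rightarrow> 'a::comm_monoid_add"
  shows
  "(\<Sum>\<rho>\<in>rows (m # ms). f \<rho>) = (\<Sum>c\<in>conds m. f (0, c)) + (\<Sum>\<rho>\<in>rows ms. f (Suc (fst \<rho>), snd \<rho>))"
proof -
  have "sum f (rows ms) = (\<Sum>j<length ms. \<Sum>c\<in>conds (ms ! j). f (j, c))"
    for f :: "nat \<times> nat \<times> nat \<Rightarrow> 'a" and ms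
    by (simp add: rows_def sum.Sigma)
  then show ?thesis by (simp add: sum.lessThan_Suc_shift del: sum.lessThan_Suc)
qed

lemma card_rows: "card (rows ms) = (\<Sum>m\<leftarrow>ms. (m + 1) choose 2)"
proof (induction ms)
  case (Cons m ms)
  have "card (rows (m # ms)) = card (conds m) + card (rows ms)"
    using sum_rows_Cons[of "\<lambda>_. 1 :: nat" m ms] by simp
  then show ?case using Cons by (simp add: card_conds)
qed (simp add: rows_def)

fun reduces :: "nat list \<Rightarrow> nat list \<Rightarrow> nat list \<Rightarrow> bool" where
  "reduces [] S T \<longleftrightarrow> S = T"
| "reduces (m # ms) S T \<longleftrightarrow> (\<exists>U. m_reduction m S = Some U \<and> reduces ms (strip_zeros U) T)"

definition row_coeff :: "nat \<Rightarrow> proj_plane list \<Rightarrow> nat \<times> nat \<times> nat \<Rightarrow> nat \<times> nat \<Rightarrow> complex" where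
  "row_coeff d Ps = (\<lambda>(j, c). cond_coeff d (($) (rep_proj_plane (Ps ! j))) c)"

text \<open>The numbers removed are 1, ..., m in some order, and their sum is the number of
  conditions of an \<open>m\<close>-fold point.\<close>

lemma m_reduction_size:
  assumes "m_reduction m S = Some S'"
  shows "diagram S' \<subseteq> diagram S" "sum_list S = sum_list S' + ((m + 1) choose 2)"
proof -
  obtain r where r: "inj_on r {length S - m..<length S}" "r ` {length S - m..<length S} = {1..m}"
    "\<And>k. k \<in> {length S - m..<length S} \<Longrightarrow> r k \<le> S ! k"
    "\<And>k. k < length S - m \<Longrightarrow> r k = 0"
    "\<And>k. k < length S \<Longrightarrow> S' ! k = S ! k - r k" "length S' = length S"
    using m_reduction_removed[OF assms] by metis
  show "diagram S' \<subseteq> diagram S" using r(5,6) by (auto simp: diagram_def)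
  have le: "r k \<le> S ! k" if "k < length S" for k
    using r(3,4)[of k] that by (cases "k < length S - m") auto
  have "sum_list S = (\<Sum>k<length S. S' ! k + r k)"
    unfolding sum_list_sum_nth atLeast0LessThan using le r(5) by (intro sum.cong) auto
  also have "\<dots> = sum_list S' + (\<Sum>k<length S. r k)"
    by (simp add: sum.distrib sum_list_sum_nth atLeast0LessThan r(6))
  also have "(\<Sum>k<length S. r k) = (\<Sum>k\<in>{length S - m..<length S}. r k)"
    using r(4) by (intro sum.mono_neutral_right) auto
  also have "\<dots> = \<Sum>{1..m}" using sum.reindex[OF r(1), of "\<lambda>x. x"] r(2) by simp
  also have "\<dots> = (m + 1) choose 2" by (induction m) (auto simp: numeral_2_eq_2)
  finally show "sum_list S = sum_list S' + ((m + 1) choose 2)" .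
qed

lemma reduces_size: "reduces ms S T \<Longrightarrow> sum_list S = sum_list T + card (rows ms)"
proof (induction ms arbitrary: S)
  case (Cons m ms)
  then obtain U where U: "m_reduction m S = Some U" "reduces ms (strip_zeros U) T" by auto
  have "sum_list (strip_zeros U) = sum_list U" by (metis card_diagram diagram_strip_zeros)
  then show ?case using Cons.IH[OF U(2)] m_reduction_size(2)[OF U(1)] by (simp add: card_rows)
qed (simp add: rows_def)

text \<open>The points for the tail of \<open>ms\<close> come first, from the induction hypothesis
  on the smaller diagram of survivors; the point for the head is then placed relative to
  them.\<close>

lemma reduces_independent:
  assumes "reduces ms S T" "diagram S \<subseteq> {(k, h). h \<le> k \<and> k \<le> d}"
  shows "\<exists>Ps. length Ps = length ms \<and> (\<forall>P\<in>set Ps. rep_proj_plane P $ 2 \<noteq> 0) \<and>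
    (\<forall>\<nu>. (\<forall>e\<in>diagram S. (\<Sum>\<rho>\<in>rows ms. \<nu> \<rho> * row_coeff d Ps \<rho> e) = 0) \<longrightarrow>
      (\<forall>\<rho>\<in>rows ms. \<nu> \<rho> = 0))"
  using assms
proof (induction ms arbitrary: S)
  case Nil
  then show ?case by (simp add: rows_def)
next
  case (Cons m ms)
  then obtain U where U: "m_reduction m S = Some U" "reduces ms (strip_zeros U) T" by auto
  have "diagram (strip_zeros U) \<subseteq> {(k, h). h \<le> k \<and> k \<le> d}"
    using m_reduction_size(1)[OF U(1)] Cons.prems(2) by (simp add: diagram_strip_zeros)
  from Cons.IH[OF U(2) this] obtain Ps where Ps: "length Ps = length ms"
    "\<forall>P\<in>set Ps. rep_proj_plane P $ 2 \<noteq> 0"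
    "\<And>\<nu>. (\<And>e. e \<in> diagram U \<Longrightarrow> (\<Sum>\<rho>\<in>rows ms. \<nu> \<rho> * row_coeff d Ps \<rho> e) = 0) \<Longrightarrow>
      (\<forall>\<rho>\<in>rows ms. \<nu> \<rho> = 0)"
    unfolding diagram_strip_zeros by metis
  from exists_torus_point[OF U(1) Cons.prems(2) finite_rows Ps(3)]
  obtain P where P: "rep_proj_plane P $ 2 \<noteq> 0"
    "\<And>\<mu> \<nu>. (\<forall>e\<in>diagram S. (\<Sum>c\<in>conds m. \<mu> c * cond_coeff d (($) (rep_proj_plane P)) c e) +
       (\<Sum>\<rho>\<in>rows ms. \<nu> \<rho> * row_coeff d Ps \<rho> e) = 0) \<Longrightarrow>
      (\<forall>c\<in>conds m. \<mu> c = 0) \<and> (\<forall>\<rho>\<in>rows ms. \<nu> \<rho> = 0)"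
    by blast
  show ?case
  proof (intro exI[of _ "P # Ps"] conjI allI impI)
    show "length (P # Ps) = length (m # ms)" "\<forall>P\<in>set (P # Ps). rep_proj_plane P $ 2 \<noteq> 0"
      using Ps P(1) by auto
    fix \<nu> assume "\<forall>e\<in>diagram S. (\<Sum>\<rho>\<in>rows (m # ms). \<nu> \<rho> * row_coeff d (P # Ps) \<rho> e) = 0"
    then have "\<forall>e\<in>diagram S. (\<Sum>c\<in>conds m. \<nu> (0, c) * cond_coeff d (($) (rep_proj_plane P)) c e) +
       (\<Sum>\<rho>\<in>rows ms. \<nu> (Suc (fst \<rho>), snd \<rho>) * row_coeff d Ps \<rho> e) = 0"
      by (simp add: sum_rows_Cons row_coeff_def case_prod_beta)
    from P(2)[OF this] have
      *: "\<forall>c\<in>conds m. \<nu> (0, c) = 0" "\<forall>\<rho>\<in>rows ms. \<nu> (Suc (fst \<rho>), snd \<rho>) = 0" by auto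
    show "\<forall>\<rho>\<in>rows (m # ms). \<nu> \<rho> = 0"
    proof
      fix \<rho> assume \<rho>: "\<rho> \<in> rows (m # ms)"
      obtain j c where jc: "\<rho> = (j, c)" by (cases \<rho>)
      show "\<nu> \<rho> = 0"
      proof (cases j)
        case 0
        then show ?thesis using \<rho> *(1) jc by (simp add: rows_def)
      next
        case (Suc i)
        then have "(i, c) \<in> rows ms" using \<rho> jc by (simp add: rows_def)
        then show ?thesis using *(2) Suc jc by force
      qed
    qed
  qed
qed

section \<open>Evaluation and determinants of polynomials\<close>

definition mon_eval :: "('v \<Rightarrow> complex) \<Rightarrow> ('v \<Rightarrow>\<^sub>0 nat) \<Rightarrow> complex" where
  "mon_eval x a = (\<Prod>v\<in>Poly_Mapping.keys a. x v ^ Poly_Mapping.lookup a v)"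

lemma mon_eval_superset:
  assumes "finite A" "Poly_Mapping.keys a \<subseteq> A"
  shows "mon_eval x a = (\<Prod>v\<in>A. x v ^ Poly_Mapping.lookup a v)"
  unfolding mon_eval_def using assms
  by (intro prod.mono_neutral_left) (auto simp: in_keys_iff)

lemma mon_eval_0 [simp]: "mon_eval x 0 = 1"
  by (simp add: mon_eval_def)

lemma mon_eval_single [simp]: "mon_eval x (Poly_Mapping.single v n) = x v ^ n"
  by (simp add: mon_eval_def)

lemma mon_eval_add: "mon_eval x (a + b) = mon_eval x a * mon_eval x b"
proof -
  let ?A = "Poly_Mapping.keys a \<union> Poly_Mapping.keys b"
  have "Poly_Mapping.keys (a + b) \<subseteq> ?A" by (rule Poly_Mapping.keys_add)
  then show ?thesis
    by (simp add: mon_eval_superset[of ?A] lookup_add power_add prod.distrib)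
qed

lemma mp_eval_superset:
  assumes "finite A" "Poly_Mapping.keys F \<subseteq> A"
  shows "mp_eval F x = (\<Sum>a\<in>A. Poly_Mapping.lookup F a * mon_eval x a)"
  unfolding mp_eval_def mon_eval_def[symmetric] using assms
  by (intro sum.mono_neutral_left) (auto simp: in_keys_iff)

lemma mp_eval_single [simp]: "mp_eval (Poly_Mapping.single a c) x = c * mon_eval x a"
  using mp_eval_superset[of "{a}" "Poly_Mapping.single a c" x] by simp

lemma mp_eval_add: "mp_eval (F + G) x = mp_eval F x + mp_eval G x"
proof -
  let ?A = "Poly_Mapping.keys F \<union> Poly_Mapping.keys G"
  have "Poly_Mapping.keys (F + G) \<subseteq> ?A" by (rule Poly_Mapping.keys_add)
  then show ?thesis
    by (simp add: mp_eval_superset[of ?A] lookup_add distrib_right sum.distrib)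
qed

lemma mp_eval_0 [simp]: "mp_eval 0 x = 0"
  by (simp add: mp_eval_def)

lemma mp_eval_sum: "mp_eval (\<Sum>i\<in>I. F i) x = (\<Sum>i\<in>I. mp_eval (F i) x)"
  by (induction I rule: infinite_finite_induct) (simp_all add: mp_eval_add)

lemma sum_single_lookup:
  assumes "finite A" "Poly_Mapping.keys F \<subseteq> A"
  shows "F = (\<Sum>a\<in>A. Poly_Mapping.single a (Poly_Mapping.lookup F a))"
proof (rule poly_mapping_eqI)
  fix b
  have "(\<Sum>a\<in>A. Poly_Mapping.lookup (Poly_Mapping.single a (Poly_Mapping.lookup F a)) b) =
      (\<Sum>a\<in>A. if a = b then Poly_Mapping.lookup F a else 0)"
    by (intro sum.cong) (auto simp: lookup_single when_def)
  then show "Poly_Mapping.lookup F b =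
      Poly_Mapping.lookup (\<Sum>a\<in>A. Poly_Mapping.single a (Poly_Mapping.lookup F a)) b"
    using assms by (auto simp: lookup_sum in_keys_iff)
qed

lemma mp_eval_mult: "mp_eval (F * G) x = mp_eval F x * mp_eval G x"
proof -
  let ?F = "\<lambda>a. Poly_Mapping.single a (Poly_Mapping.lookup F a)"
  let ?G = "\<lambda>a. Poly_Mapping.single a (Poly_Mapping.lookup G a)"
  have "F * G = (\<Sum>a\<in>Poly_Mapping.keys F. ?F a) * (\<Sum>b\<in>Poly_Mapping.keys G. ?G b)"
    using sum_single_lookup[of "Poly_Mapping.keys F" F] sum_single_lookup[of "Poly_Mapping.keys G" G]
    by simp
  also have "mp_eval \<dots> x = (\<Sum>a\<in>Poly_Mapping.keys F. mp_eval (?F a) x) * (\<Sum>b\<in>Poly_Mapping.keys G. mp_eval (?G b) x)"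
    by (simp add: sum_product mp_eval_sum mult_single mon_eval_add mult_ac)
  also have "\<dots> = mp_eval F x * mp_eval G x"
    by (simp only: mp_eval_single) (simp add: mp_eval_def mon_eval_def)
  finally show ?thesis .
qed

lemma mp_eval_of_int [simp]: "mp_eval (of_int n) x = of_int n"
  by (metis mp_eval_single single_of_int mon_eval_0 mult.right_neutral)

lemma mp_eval_1 [simp]: "mp_eval 1 x = 1"
  using mp_eval_of_int[of 1 x] by simp

lemma mp_eval_prod: "mp_eval (\<Prod>i\<in>I. F i) x = (\<Prod>i\<in>I. mp_eval (F i) x)"
  by (induction I rule: infinite_finite_induct) (simp_all add: mp_eval_mult)

lemma mp_eval_det:
  "mp_eval (det (mat n n M)) x = det (mat n n (\<lambda>ij. mp_eval (M ij) x))"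
  by (subst (1 2) det_def') (auto simp: mp_eval_sum mp_eval_mult mp_eval_prod
    intro!: sum.cong prod.cong)


text \<open>The degrees are a parameter because \<open>multihomogeneous\<close> only asserts that
  some exist and is therefore not preserved by sums. The zero polynomial has every
  multidegree.\<close>

definition multidegree :: "nat \<Rightarrow> (nat \<Rightarrow> nat) \<Rightarrow> (nat \<times> 3) mpoly \<Rightarrow> bool" where
  "multidegree s \<delta> F \<longleftrightarrow> (\<forall>a\<in>Poly_Mapping.keys F. Poly_Mapping.keys a \<subseteq> {..<s} \<times> UNIV \<and>
     (\<forall>i<s. (\<Sum>k\<in>UNIV. Poly_Mapping.lookup a (i, k)) = \<delta> i))"

lemma multidegree_multihomogeneous: "multidegree s \<delta> F \<Longrightarrow> multihomogeneous s F"
  by (auto simp: multidegree_def multihomogeneous_def)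

lemma multidegree_0: "multidegree s \<delta> 0"
  by (simp add: multidegree_def)

lemma multidegree_const: "multidegree s (\<lambda>i. 0) (Poly_Mapping.single 0 c)"
  by (simp add: multidegree_def)

lemma multidegree_of_int: "multidegree s (\<lambda>i. 0) (of_int n)"
  by (metis multidegree_const single_of_int)

lemma multidegree_add: "multidegree s \<delta> F \<Longrightarrow> multidegree s \<delta> G \<Longrightarrow> multidegree s \<delta> (F + G)"
  unfolding multidegree_def using Poly_Mapping.keys_add[of F G] by blast

lemma multidegree_sum: "(\<And>i. i \<in> I \<Longrightarrow> multidegree s \<delta> (F i)) \<Longrightarrow> multidegree s \<delta> (\<Sum>i\<in>I. F i)"
  by (induction I rule: infinite_finite_induct) (auto simp: multidegree_0 multidegree_add)

lemma multidegree_mult: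
  assumes "multidegree s \<delta> F" "multidegree s \<epsilon> G"
  shows "multidegree s (\<lambda>i. \<delta> i + \<epsilon> i) (F * G)"
  unfolding multidegree_def
proof
  fix c assume "c \<in> Poly_Mapping.keys (F * G)"
  then obtain a b where ab: "c = a + b" "a \<in> Poly_Mapping.keys F" "b \<in> Poly_Mapping.keys G"
    using Poly_Mapping.keys_mult[of F G] by blast
  have "Poly_Mapping.keys c \<subseteq> Poly_Mapping.keys a \<union> Poly_Mapping.keys b"
    unfolding ab(1) by (rule Poly_Mapping.keys_add)
  then show "Poly_Mapping.keys c \<subseteq> {..<s} \<times> UNIV \<and>
     (\<forall>i<s. (\<Sum>k\<in>UNIV. Poly_Mapping.lookup c (i, k)) = \<delta> i + \<epsilon> i)"
    using assms ab unfolding multidegree_def by (fastforce simp: lookup_add sum.distrib)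
qed

lemma multidegree_prod:
  assumes "finite I" "\<And>i. i \<in> I \<Longrightarrow> multidegree s (\<delta> i) (F i)"
  shows "multidegree s (\<lambda>j. \<Sum>i\<in>I. \<delta> i j) (\<Prod>i\<in>I. F i)"
  using assms
proof (induction I rule: finite_induct)
  case empty
  then show ?case using multidegree_const[of s 1] by simp
next
  case (insert i I)
  then show ?case using multidegree_mult[of s "\<delta> i" "F i"] by simp
qed

text \<open>Each term of the Leibniz expansion takes one entry from every row; as the multidegree of
  an entry depends only on its row, all terms have the same multidegree.\<close>

lemma multidegree_det:
  assumes "\<And>i j. i < n \<Longrightarrow> j < n \<Longrightarrow> multidegree s (\<delta> i) (M (i, j))"
  shows "multidegree s (\<lambda>k. \<Sum>i<n. \<delta> i k) (det (mat n n M))"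
proof -
  have "multidegree s (\<lambda>k. \<Sum>i<n. \<delta> i k) (of_int (sign p) * (\<Prod>i = 0..<n. M (i, p i)))"
    if p: "p permutes {0..<n}" for p
  proof -
    have "multidegree s (\<lambda>k. \<Sum>i\<in>{0..<n}. \<delta> i k) (\<Prod>i = 0..<n. M (i, p i))"
    proof (rule multidegree_prod)
      fix i assume i: "i \<in> {0..<n}"
      have "p i \<in> {0..<n}" using permutes_in_image[OF p] i by blast
      then show "multidegree s (\<delta> i) (M (i, p i))" using assms i by simp
    qed simp
    from multidegree_mult[OF multidegree_of_int this] show ?thesis
      by (simp add: atLeast0LessThan)
  qed
  then have *: "multidegree s (\<lambda>k. \<Sum>i<n. \<delta> i k)
      (\<Sum>p\<in>{p. p permutes {0..<n}}. of_int (sign p) * (\<Prod>i = 0..<n. M (i, p i)))"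
    by (intro multidegree_sum) simp
  have "det (mat n n M) =
      (\<Sum>p\<in>{p. p permutes {0..<n}}. of_int (sign p) * (\<Prod>i = 0..<n. M (i, p i)))"
    by (subst det_def') (auto intro!: sum.cong prod.cong simp: permutes_in_image)
  then show ?thesis using * by simp
qed

lemma left_kernel_trivial:
  fixes M :: "nat \<times> nat \<Rightarrow> 'a::field"
  assumes "det (mat n n M) \<noteq> 0" "\<And>j. j < n \<Longrightarrow> (\<Sum>i<n. \<nu> i * M (i, j)) = 0" "i < n"
  shows "\<nu> i = 0"
proof -
  let ?T = "transpose_mat (mat n n M)"
  have "det ?T \<noteq> 0" using assms(1) det_transpose[of "mat n n M" n] by simp
  moreover have "?T *\<^sub>v vec n \<nu> = 0\<^sub>v n"
  proof (rule eq_vecI)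
    fix j assume "j < dim_vec (0\<^sub>v n :: 'a vec)"
    then have j: "j < n" by simp
    have "vec_index (?T *\<^sub>v vec n \<nu>) j = (\<Sum>i<n. M (i, j) * \<nu> i)"
      using j by (simp add: scalar_prod_def atLeast0LessThan)
    then show "vec_index (?T *\<^sub>v vec n \<nu>) j = vec_index (0\<^sub>v n) j"
      using assms(2)[OF j] j by (simp add: mult.commute)
  qed simp
  ultimately have "vec n \<nu> = 0\<^sub>v n"
    using det_0_iff_vec_prod_zero[of ?T n] by (metis mat_carrier transpose_carrier_mat vec_carrier)
  then have "vec_index (vec n \<nu>) i = vec_index (0\<^sub>v n) i" by simp
  then show ?thesis using assms(3) by simp
qed

section \<open>Derivatives of forms\<close>

lemma mp_deriv_superset:
  assumes "finite A" "Poly_Mapping.keys F \<subseteq> A"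
  shows "mp_deriv v F = (\<Sum>a\<in>A. Poly_Mapping.single (a - Poly_Mapping.single v 1)
          (of_nat (Poly_Mapping.lookup a v) * Poly_Mapping.lookup F a))"
  unfolding mp_deriv_def using assms
  by (intro sum.mono_neutral_left) (auto simp: in_keys_iff)

lemma mp_deriv_add: "mp_deriv v (F + G) = mp_deriv v F + mp_deriv v G"
proof -
  let ?A = "Poly_Mapping.keys F \<union> Poly_Mapping.keys G"
  have "Poly_Mapping.keys (F + G) \<subseteq> ?A" by (rule Poly_Mapping.keys_add)
  then show ?thesis
    by (simp add: mp_deriv_superset[of ?A] lookup_add distrib_left single_add sum.distrib)
qed

lemma mp_deriv_sum: "mp_deriv v (\<Sum>i\<in>I. F i) = (\<Sum>i\<in>I. mp_deriv v (F i))"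
  by (induction I rule: infinite_finite_induct) (simp_all add: mp_deriv_add mp_deriv_def[of v 0])

lemma mp_deriv_single:
  "mp_deriv v (Poly_Mapping.single a c) =
     Poly_Mapping.single (a - Poly_Mapping.single v 1) (of_nat (Poly_Mapping.lookup a v) * c)"
  using mp_deriv_superset[of "{a}" "Poly_Mapping.single a c" v] by simp

lemma mp_derivs_sum:
  "foldr mp_deriv vs (\<Sum>i\<in>I. F i) = (\<Sum>i\<in>I. foldr mp_deriv vs (F i))"
  by (induction vs) (simp_all add: mp_deriv_sum)

lemma mp_derivs_single:
  fixes vs :: "'v::finite list"
  shows "\<exists>b. (\<forall>w. Poly_Mapping.lookup b w = Poly_Mapping.lookup a w - count_list vs w) \<and>
    foldr mp_deriv vs (Poly_Mapping.single a c) =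
      Poly_Mapping.single b (c * (\<Prod>w\<in>UNIV. ff (of_nat (Poly_Mapping.lookup a w)) (count_list vs w)))"
proof (induction vs)
  case (Cons v vs)
  let ?P = "\<lambda>vs. (\<Prod>w\<in>UNIV. ff (of_nat (Poly_Mapping.lookup a w)) (count_list vs w))"
  obtain b where b: "\<And>w. Poly_Mapping.lookup b w = Poly_Mapping.lookup a w - count_list vs w"
    "foldr mp_deriv vs (Poly_Mapping.single a c) = Poly_Mapping.single b (c * ?P vs)"
    using Cons.IH by blast
  let ?n = "Poly_Mapping.lookup a v" and ?k = "count_list vs v"
  have "of_nat (?n - ?k) * ff (of_nat ?n) ?k = ff (of_nat ?n) (Suc ?k)"
    using ff_eq_0[of ?n ?k] by (cases "?n < ?k") (auto simp: ff_Suc of_nat_diff mult.commute)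
  then have "of_nat (?n - ?k) * ?P vs = ?P (v # vs)"
    unfolding prod.remove[OF finite UNIV_I[of v]] by (simp add: mult.assoc[symmetric])
  then have "foldr mp_deriv (v # vs) (Poly_Mapping.single a c) =
      Poly_Mapping.single (b - Poly_Mapping.single v 1) (c * ?P (v # vs))"
    by (simp add: b mp_deriv_single mult.left_commute)
  moreover have "Poly_Mapping.lookup (b - Poly_Mapping.single v 1) w =
      Poly_Mapping.lookup a w - count_list (v # vs) w" for w
    by (simp add: lookup_minus b lookup_single when_def)
  ultimately show ?case by blast
qed (auto intro: exI[of _ a])

definition deriv_at :: "('v::finite \<Rightarrow> complex) \<Rightarrow> ('v \<Rightarrow> nat) \<Rightarrow> 'v mpoly \<Rightarrow> complex" where
  "deriv_at x c F = (\<Sum>a\<in>Poly_Mapping.keys F. Poly_Mapping.lookup F a *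
     (\<Prod>w\<in>UNIV. ff (of_nat (Poly_Mapping.lookup a w)) (c w) * x w ^ (Poly_Mapping.lookup a w - c w)))"

lemma mp_eval_derivs: "mp_eval (foldr mp_deriv vs F) x = deriv_at x (count_list vs) F"
proof -
  have "mp_eval (foldr mp_deriv vs (Poly_Mapping.single a c)) x = c * (\<Prod>w\<in>UNIV.
      ff (of_nat (Poly_Mapping.lookup a w)) (count_list vs w) *
        x w ^ (Poly_Mapping.lookup a w - count_list vs w))" for a c
  proof -
    obtain b where b: "\<And>w. Poly_Mapping.lookup b w = Poly_Mapping.lookup a w - count_list vs w"
      "foldr mp_deriv vs (Poly_Mapping.single a c) =
      Poly_Mapping.single b (c * (\<Prod>w\<in>UNIV. ff (of_nat (Poly_Mapping.lookup a w)) (count_list vs w)))"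
      using mp_derivs_single[of a vs c] by blast
    show ?thesis
      by (simp add: b(2) mon_eval_superset[of UNIV] b(1) prod.distrib)
  qed
  then show ?thesis
    by (subst sum_single_lookup[OF finite_keys subset_refl, of F])
      (simp add: mp_derivs_sum mp_eval_sum deriv_at_def)
qed

lemma vanishes_to_order_deriv_at:
  "vanishes_to_order m P F \<longleftrightarrow>
     (\<forall>c. c 1 + c 2 + c 3 < m \<longrightarrow> deriv_at (($) (rep_proj_plane P)) c F = 0)"
proof
  assume *: "vanishes_to_order m P F"
  show "\<forall>c. c 1 + c 2 + c 3 < m \<longrightarrow> deriv_at (($) (rep_proj_plane P)) c F = 0"
  proof (intro allI impI)
    fix c :: "3 \<Rightarrow> nat" assume c: "c 1 + c 2 + c 3 < m"
    define vs :: "3 list" where "vs = replicate (c 1) 1 @ replicate (c 2) 2 @ replicate (c 3) 3"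
    have cnt: "count_list (replicate n v) w = (if v = w then n else 0)" for n and v w :: 3
      by (induction n) auto
    have "count_list vs w = c w" for w
      using exhaust_3[of w] by (auto simp: vs_def cnt)
    then have "count_list vs = c" by auto
    moreover have "length vs < m" using c by (simp add: vs_def)
    ultimately show "deriv_at (($) (rep_proj_plane P)) c F = 0"
      using * mp_eval_derivs unfolding vanishes_to_order_def by metis
  qed
next
  assume *: "\<forall>c. c 1 + c 2 + c 3 < m \<longrightarrow> deriv_at (($) (rep_proj_plane P)) c F = 0"
  have "length vs = count_list vs 1 + count_list vs 2 + count_list vs 3" for vs :: "3 list"
    using sum_count_set[of vs UNIV] by (simp add: sum_3)
  then show "vanishes_to_order m P F"
    using * by (auto simp: vanishes_to_order_def mp_eval_derivs)
qed

lemma deriv_at_Euler: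
  fixes x :: "3 \<Rightarrow> complex"
  assumes "is_form d F"
  shows "(\<Sum>v\<in>UNIV. x v * deriv_at x (c(v := Suc (c v))) F) =
    (of_nat d - (\<Sum>v\<in>UNIV. of_nat (c v))) * deriv_at x c F"
proof -
  let ?T = "\<lambda>c a w. ff (of_nat (Poly_Mapping.lookup a w)) (c w) *
    x w ^ (Poly_Mapping.lookup a w - c w)"
  have 1: "x v * (\<Prod>w\<in>UNIV. ?T (c(v := Suc (c v))) a w) =
      (of_nat (Poly_Mapping.lookup a v) - of_nat (c v)) * (\<Prod>w\<in>UNIV. ?T c a w)" for a v
  proof -
    have "x v * ?T (c(v := Suc (c v))) a v =
      (of_nat (Poly_Mapping.lookup a v) - of_nat (c v)) * ?T c a v"
    proof (cases "c v < Poly_Mapping.lookup a v")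
      case True
      then have "Poly_Mapping.lookup a v - c v = Suc (Poly_Mapping.lookup a v - Suc (c v))" by simp
      then show ?thesis by (simp add: ff_Suc)
    next
      case False
      then show ?thesis
        by (cases "c v = Poly_Mapping.lookup a v") (auto simp: ff_eq_0)
    qed
    moreover have "(\<Prod>w\<in>UNIV - {v}. ?T (c(v := Suc (c v))) a w) = (\<Prod>w\<in>UNIV - {v}. ?T c a w)"
      by (intro prod.cong) auto
    ultimately show ?thesis
      unfolding prod.remove[OF finite UNIV_I[of v]] by (simp only: mult.assoc[symmetric])
  qed
  have "(\<Sum>v\<in>UNIV. x v * deriv_at x (c(v := Suc (c v))) F) =
      (\<Sum>a\<in>Poly_Mapping.keys F. \<Sum>v\<in>UNIV. Poly_Mapping.lookup F a *
        (x v * (\<Prod>w\<in>UNIV. ?T (c(v := Suc (c v))) a w)))"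
    unfolding deriv_at_def sum_distrib_left by (subst sum.swap) (simp only: mult.left_commute)
  also have "\<dots> = (\<Sum>a\<in>Poly_Mapping.keys F.
      (of_nat d - (\<Sum>v\<in>UNIV. of_nat (c v))) * (Poly_Mapping.lookup F a * (\<Prod>w\<in>UNIV. ?T c a w)))"
  proof (intro sum.cong refl)
    fix a assume "a \<in> Poly_Mapping.keys F"
    then have "(\<Sum>v\<in>UNIV. Poly_Mapping.lookup a v) = d" using assms by (simp add: is_form_def)
    then have d: "(\<Sum>v\<in>UNIV. of_nat (Poly_Mapping.lookup a v)) = (of_nat d :: complex)"
      by (metis of_nat_sum)
    show "(\<Sum>v\<in>UNIV. Poly_Mapping.lookup F a * (x v * (\<Prod>w\<in>UNIV. ?T (c(v := Suc (c v))) a w))) =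
        (of_nat d - (\<Sum>v\<in>UNIV. of_nat (c v))) * (Poly_Mapping.lookup F a * (\<Prod>w\<in>UNIV. ?T c a w))"
      unfolding 1 sum_distrib_left[symmetric] sum_distrib_right[symmetric] sum_subtractf d
      by (simp only: mult.left_commute)
  qed
  finally show ?thesis by (simp only: deriv_at_def sum_distrib_left)
qed

lemma deriv_at_zero_from_two_variables:
  fixes x :: "3 \<Rightarrow> complex"
  assumes F: "is_form d F" and x: "x 2 \<noteq> 0"
    and z: "\<And>c. c 2 = 0 \<Longrightarrow> c 1 + c 3 < m \<Longrightarrow> deriv_at x c F = 0"
  shows "c 1 + c 2 + c 3 < m \<Longrightarrow> deriv_at x c F = 0"
proof (induction "c 2" arbitrary: c)
  case 0
  then show ?case using z by simp
next
  case (Suc n)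
  define c' where "c' = c(2 := n)"
  have c: "c'(2 := Suc (c' 2)) = c" using Suc.hyps(2) by (auto simp: c'_def)
  have "deriv_at x c' F = 0" "deriv_at x (c'(1 := Suc (c' 1))) F = 0"
    "deriv_at x (c'(3 := Suc (c' 3))) F = 0"
    using Suc.prems Suc.hyps(2) by (auto intro!: Suc.hyps(1) simp: c'_def)
  then have "x 2 * deriv_at x c F = 0"
    using deriv_at_Euler[OF F, of x c'] by (simp add: sum_3 c)
  then show ?case using x by simp
qed

definition expo :: "nat \<Rightarrow> nat \<times> nat \<Rightarrow> 3 \<Rightarrow>\<^sub>0 nat" where
  "expo d = (\<lambda>(k, h). Poly_Mapping.single 1 h + Poly_Mapping.single 2 (k - h) +
     Poly_Mapping.single 3 (d - k))"

definition triangle :: "nat \<Rightarrow> (nat \<times> nat) set" where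
  "triangle d = {(k, h). h \<le> k \<and> k \<le> d}"

lemma finite_triangle [simp]: "finite (triangle d)"
  by (rule finite_subset[of _ "{..d} \<times> {..d}"]) (auto simp: triangle_def)

lemma diagram_staircase: "diagram [1..<d + 2] = triangle d"
  by (auto simp: diagram_def triangle_def simp del: upt_Suc)

lemma lookup_expo:
  "Poly_Mapping.lookup (expo d (k, h)) 1 = h" "Poly_Mapping.lookup (expo d (k, h)) 2 = k - h"
  "Poly_Mapping.lookup (expo d (k, h)) 3 = d - k"
  by (simp_all add: expo_def lookup_add lookup_single)

lemma inj_on_expo: "inj_on (expo d) (triangle d)"
proof (rule inj_onI, clarify)
  fix k h k' h'
  assume *: "(k, h) \<in> triangle d" "(k', h') \<in> triangle d" "expo d (k, h) = expo d (k', h')"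
  then have "h = h'" "d - k = d - k'" using lookup_expo by metis+
  then show "k = k' \<and> h = h'" using * by (auto simp: triangle_def)
qed

lemma expo_image: "expo d ` triangle d = {a. (\<Sum>v\<in>UNIV. Poly_Mapping.lookup a v) = d}"
proof (intro equalityI subsetI)
  fix a assume "a \<in> expo d ` triangle d"
  then show "a \<in> {a. (\<Sum>v\<in>UNIV. Poly_Mapping.lookup a v) = d}"
    by (auto simp: triangle_def sum_3 lookup_expo)
next
  fix a :: "3 \<Rightarrow>\<^sub>0 nat" assume "a \<in> {a. (\<Sum>v\<in>UNIV. Poly_Mapping.lookup a v) = d}"
  then have d: "d = Poly_Mapping.lookup a 1 + Poly_Mapping.lookup a 2 + Poly_Mapping.lookup a 3"
    by (simp add: sum_3)
  let ?e = "(Poly_Mapping.lookup a 1 + Poly_Mapping.lookup a 2, Poly_Mapping.lookup a 1)"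
  have "a = expo d ?e"
  proof (rule poly_mapping_eqI)
    fix v :: 3
    show "Poly_Mapping.lookup a v = Poly_Mapping.lookup (expo d ?e) v"
      using exhaust_3[of v] by (auto simp: lookup_expo d)
  qed
  moreover have "?e \<in> triangle d" by (simp add: triangle_def d)
  ultimately show "a \<in> expo d ` triangle d" by blast
qed

lemma is_form_iff: "is_form d F \<longleftrightarrow> Poly_Mapping.keys F \<subseteq> expo d ` triangle d"
  by (auto simp: is_form_def expo_image)

lemma deriv_at_form:
  assumes "is_form d F" "c 2 = 0"
  shows "deriv_at x c F =
    (\<Sum>e\<in>triangle d. Poly_Mapping.lookup F (expo d e) * cond_coeff d x (c 1, c 3) e)"
proof -
  have "deriv_at x c F = (\<Sum>a\<in>expo d ` triangle d. Poly_Mapping.lookup F a *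
     (\<Prod>w\<in>UNIV. ff (of_nat (Poly_Mapping.lookup a w)) (c w) * x w ^ (Poly_Mapping.lookup a w - c w)))"
    unfolding deriv_at_def using assms(1)
    by (intro sum.mono_neutral_left) (auto simp: is_form_iff in_keys_iff)
  also have "\<dots> = (\<Sum>e\<in>triangle d. Poly_Mapping.lookup F (expo d e) * cond_coeff d x (c 1, c 3) e)"
    unfolding sum.reindex[OF inj_on_expo] o_def
  proof (intro sum.cong refl)
    fix e assume "e \<in> triangle d"
    obtain k h where e: "e = (k, h)" by (cases e)
    have prod3: "(\<Prod>w\<in>UNIV. f w) = f 1 * f 2 * f 3" for f :: "3 \<Rightarrow> complex"
      unfolding UNIV_3 by (simp add: mult.assoc)
    show "Poly_Mapping.lookup F (expo d e) * (\<Prod>w\<in>UNIV. ff (of_nat (Poly_Mapping.lookup (expo d e) w)) (c w) *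
        x w ^ (Poly_Mapping.lookup (expo d e) w - c w)) =
      Poly_Mapping.lookup F (expo d e) * cond_coeff d x (c 1, c 3) e"
      unfolding e prod3 lookup_expo cond_coeff_def prod.case assms(2) by (simp add: mult_ac)
  qed
  finally show ?thesis .
qed

section \<open>General points\<close>

lemma lookup_mp_scale [simp]:
  "Poly_Mapping.lookup (mp_scale c F) a = c * Poly_Mapping.lookup F a"
  by (simp add: mp_scale_def mult_map_scale_conv_mult[symmetric] Poly_Mapping.map.rep_eq when_def)

lemma is_form_lookup:
  "is_form d F \<longleftrightarrow> (\<forall>a. a \<notin> expo d ` triangle d \<longrightarrow> Poly_Mapping.lookup F a = 0)"
  by (auto simp: is_form_iff in_keys_iff)

lemma subspace_forms: "mpoly_space.subspace {F. is_form d F}"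
  by (rule mpoly_space.subspaceI) (auto simp: is_form_lookup lookup_add)

definition form_of :: "nat \<Rightarrow> (nat \<times> nat \<Rightarrow> complex) \<Rightarrow> 3 mpoly" where
  "form_of d f = (\<Sum>e\<in>triangle d. mp_scale (f e) (Poly_Mapping.single (expo d e) 1))"

lemma lookup_form_of:
  assumes "e \<in> triangle d"
  shows "Poly_Mapping.lookup (form_of d f) (expo d e) = f e"
proof -
  have "Poly_Mapping.lookup (form_of d f) (expo d e) =
      (\<Sum>e'\<in>triangle d. if e' = e then f e' else 0)"
    unfolding form_of_def lookup_sum using assms inj_onD[OF inj_on_expo]
    by (intro sum.cong) (auto simp: lookup_single when_def)
  then show ?thesis using assms by simp
qed

lemma is_form_form_of: "is_form d (form_of d f)"
  by (auto simp: is_form_lookup form_of_def lookup_sum lookup_single when_def intro!: sum.neutral)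

lemma form_of_lookup:
  assumes "is_form d F"
  shows "form_of d (\<lambda>e. Poly_Mapping.lookup F (expo d e)) = F"
proof (rule poly_mapping_eqI)
  fix a
  show "Poly_Mapping.lookup (form_of d (\<lambda>e. Poly_Mapping.lookup F (expo d e))) a =
      Poly_Mapping.lookup F a"
    using assms is_form_form_of[of d "\<lambda>e. Poly_Mapping.lookup F (expo d e)"] lookup_form_of
    by (cases "a \<in> expo d ` triangle d") (auto simp: is_form_lookup)
qed

definition monomial_forms :: "nat \<Rightarrow> 3 mpoly set" where
  "monomial_forms d = (\<lambda>e. Poly_Mapping.single (expo d e) 1) ` triangle d"

lemma inj_on_monomial_form: "inj_on (\<lambda>e. Poly_Mapping.single (expo d e) (1 :: complex)) (triangle d)"
proof (rule inj_onI)
  fix e e' assume *: "e \<in> triangle d" "e' \<in> triangle d"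
    "Poly_Mapping.single (expo d e) (1 :: complex) = Poly_Mapping.single (expo d e') 1"
  from arg_cong[OF *(3), of Poly_Mapping.keys] have "expo d e = expo d e'" by simp
  then show "e = e'" using *(1,2) by (rule inj_onD[OF inj_on_expo])
qed

lemma independent_monomial_forms: "mpoly_space.independent (monomial_forms d)"
proof (rule mpoly_space.independent_if_scalars_zero)
  show "finite (monomial_forms d)" by (simp add: monomial_forms_def)
  fix f x assume 0: "(\<Sum>x\<in>monomial_forms d. mp_scale (f x) x) = 0" and x: "x \<in> monomial_forms d"
  then obtain e where e: "e \<in> triangle d" "x = Poly_Mapping.single (expo d e) 1"
    by (auto simp: monomial_forms_def)
  have "form_of d (\<lambda>e. f (Poly_Mapping.single (expo d e) 1)) = 0"
    using 0 by (simp add: form_of_def monomial_forms_def sum.reindex[OF inj_on_monomial_form])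
  then show "f x = 0" using lookup_form_of[OF e(1)] e(2) by (metis lookup_zero)
qed

lemma span_monomial_forms: "mpoly_space.span (monomial_forms d) = {F. is_form d F}"
proof
  show "mpoly_space.span (monomial_forms d) \<subseteq> {F. is_form d F}"
    by (rule mpoly_space.span_minimal[OF _ subspace_forms])
      (auto simp: monomial_forms_def is_form_lookup lookup_single when_def)
  show "{F. is_form d F} \<subseteq> mpoly_space.span (monomial_forms d)"
  proof clarify
    fix F assume "is_form d F"
    then have "F = form_of d (\<lambda>e. Poly_Mapping.lookup F (expo d e))" by (simp add: form_of_lookup)
    also have "\<dots> \<in> mpoly_space.span (monomial_forms d)"
      unfolding form_of_def
      by (intro mpoly_space.span_sum mpoly_space.span_scale mpoly_space.span_base)
        (auto simp: monomial_forms_def)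
    finally show "F \<in> mpoly_space.span (monomial_forms d)" .
  qed
qed

lemma sum_staircase: "sum_list [1..<d + 2] = (d + 2) choose 2"
  by (induction d) (auto simp: numeral_2_eq_2)

lemma card_triangle: "card (triangle d) = (d + 2) choose 2"
  by (metis card_diagram diagram_staircase sum_staircase)

definition row_form :: "nat \<Rightarrow> proj_plane list \<Rightarrow> nat \<times> nat \<times> nat \<Rightarrow> 3 mpoly \<Rightarrow> complex" where
  "row_form d Ps \<rho> F = (\<Sum>e\<in>triangle d. Poly_Mapping.lookup F (expo d e) * row_coeff d Ps \<rho> e)"

lemma lin_sys_eq_kernel:
  assumes "\<forall>i<length ms. rep_proj_plane (Ps ! i) $ 2 \<noteq> 0"
  shows "lin_sys d ms Ps = {F \<in> {F. is_form d F}. \<forall>\<rho>\<in>rows ms. row_form d Ps \<rho> F = 0}"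
proof -
  have "vanishes_to_order (ms ! i) (Ps ! i) F \<longleftrightarrow> (\<forall>c\<in>conds (ms ! i). row_form d Ps (i, c) F = 0)"
    if F: "is_form d F" and i: "i < length ms" for F i
  proof
    assume v: "vanishes_to_order (ms ! i) (Ps ! i) F"
    show "\<forall>c\<in>conds (ms ! i). row_form d Ps (i, c) F = 0"
    proof
      fix c assume "c \<in> conds (ms ! i)"
      then obtain a b where c: "c = (a, b)" "a + b < ms ! i" by (auto simp: conds_def)
      define c' :: "3 \<Rightarrow> nat" where "c' w = (if w = 1 then a else if w = 2 then 0 else b)" for w
      have c': "c' 1 = a" "c' 2 = 0" "c' 3 = b" by (simp_all add: c'_def)
      have "deriv_at (($) (rep_proj_plane (Ps ! i))) c' F = 0"
        using v c(2) c' by (simp add: vanishes_to_order_deriv_at)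
      then show "row_form d Ps (i, c) F = 0"
        using deriv_at_form[where c = c', OF F c'(2)] by (simp add: row_form_def row_coeff_def c' c(1))
    qed
  next
    assume *: "\<forall>c\<in>conds (ms ! i). row_form d Ps (i, c) F = 0"
    have "deriv_at (($) (rep_proj_plane (Ps ! i))) c F = 0" if "c 2 = 0" "c 1 + c 3 < ms ! i" for c
      using bspec[OF *, of "(c 1, c 3)"] that
      by (simp add: conds_def deriv_at_form[where c = c, OF F that(1)] row_form_def row_coeff_def)
    then show "vanishes_to_order (ms ! i) (Ps ! i) F"
      using deriv_at_zero_from_two_variables[OF F] assms i
      unfolding vanishes_to_order_deriv_at by blast
  qed
  then show ?thesis by (auto simp: lin_sys_def rows_def)
qed

lemma h1_regular_if_rows_independent:
  assumes nz: "\<forall>i<length ms. rep_proj_plane (Ps ! i) $ 2 \<noteq> 0"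
    and indep: "\<And>\<nu>. (\<And>e. e \<in> triangle d \<Longrightarrow> (\<Sum>\<rho>\<in>rows ms. \<nu> \<rho> * row_coeff d Ps \<rho> e) = 0) \<Longrightarrow>
      \<forall>\<rho>\<in>rows ms. \<nu> \<rho> = 0"
    and less: "card (rows ms) < (d + 2) choose 2"
  shows "h1_regular d ms Ps"
proof -
  obtain B where B: "\<And>\<rho> \<sigma>. \<rho> \<in> rows ms \<Longrightarrow> \<sigma> \<in> rows ms \<Longrightarrow>
      (\<Sum>e\<in>triangle d. B \<rho> e * row_coeff d Ps \<sigma> e) = (if \<rho> = \<sigma> then 1 else 0)"
    using dual_family_exists[of "rows ms" "triangle d" "row_coeff d Ps", OF finite_rows finite_triangle indep]
    by auto
  have "mpoly_space.dim (lin_sys d ms Ps) + card (rows ms) = card (monomial_forms d)"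
    unfolding lin_sys_eq_kernel[OF nz]
  proof (rule mpoly_space.dim_common_kernel[OF subspace_forms _ independent_monomial_forms
        span_monomial_forms finite_rows, where b = "\<lambda>\<rho>. form_of d (B \<rho>)"])
    show "finite (monomial_forms d)" by (simp add: monomial_forms_def)
    show "row_form d Ps \<rho> (u + v) = row_form d Ps \<rho> u + row_form d Ps \<rho> v" for \<rho> u v
      by (simp add: row_form_def lookup_add distrib_right sum.distrib)
    show "row_form d Ps \<rho> (mp_scale c v) = c * row_form d Ps \<rho> v" for \<rho> c v
      by (simp add: row_form_def sum_distrib_left mult.assoc)
    show "form_of d (B \<rho>) \<in> {F. is_form d F}" for \<rho> by (simp add: is_form_form_of)
    show "row_form d Ps \<sigma> (form_of d (B \<rho>)) = (if \<rho> = \<sigma> then 1 else 0)"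
      if "\<rho> \<in> rows ms" "\<sigma> \<in> rows ms" for \<rho> \<sigma>
      unfolding B[OF that, symmetric] row_form_def by (intro sum.cong) (auto simp: lookup_form_of)
  qed
  also have "card (monomial_forms d) = (d + 2) choose 2"
    by (simp add: monomial_forms_def card_image[OF inj_on_monomial_form] card_triangle)
  finally have dim: "mpoly_space.dim (lin_sys d ms Ps) + card (rows ms) = (d + 2) choose 2" .
  have "int (card (rows ms)) = (\<Sum>m\<leftarrow>ms. int ((m + 1) choose 2))"
    unfolding card_rows by (induction ms) auto
  then have vdim: "sys_dim d ms Ps = vdim d ms" "vdim d ms \<ge> 0"
    using dim less unfolding sys_dim_def vdim_def by linarith+
  then have "non_special d ms Ps" by (simp add: non_special_def expdim_def)
  moreover have "effective d ms Ps"
  proof (rule ccontr)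
    assume "\<not> effective d ms Ps"
    then have "lin_sys d ms Ps \<subseteq> {0}" by (auto simp: effective_def)
    then have "mpoly_space.dim (lin_sys d ms Ps) = 0"
      by (intro mpoly_space.dim_unique[of "{}"]) (auto simp: mpoly_space.independent_empty)
    then show False using dim less by simp
  qed
  ultimately show ?thesis by (simp add: h1_regular_def)
qed

definition row_poly :: "nat \<Rightarrow> nat \<times> nat \<times> nat \<Rightarrow> nat \<times> nat \<Rightarrow> (nat \<times> 3) mpoly" where
  "row_poly d = (\<lambda>(j, a, b) (k, h). Poly_Mapping.single
     (Poly_Mapping.single (j, 1) (h - a) + Poly_Mapping.single (j, 2) (k - h) +
      Poly_Mapping.single (j, 3) (d - k - b))
     (ff (of_nat h) a * ff (of_nat (d - k)) b))"

lemma mp_eval_row_poly: "mp_eval (row_poly d \<rho> e) (coords Ps) = row_coeff d Ps \<rho> e"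
  by (cases \<rho>; cases e) (simp add: row_poly_def row_coeff_def cond_coeff_def coords_def mon_eval_add)

lemma multidegree_row_poly:
  assumes "j < s" "e \<in> triangle d"
  shows "multidegree s (\<lambda>i. if i = j then d - a - b else 0) (row_poly d (j, a, b) e)"
proof -
  obtain k h where e: "e = (k, h)" "h \<le> k" "k \<le> d" using assms(2) by (auto simp: triangle_def)
  define c where "c = Poly_Mapping.single (j, 1 :: 3) (h - a) + Poly_Mapping.single (j, 2) (k - h) +
      Poly_Mapping.single (j, 3) (d - k - b)"
  have row: "row_poly d (j, a, b) e = Poly_Mapping.single c (ff (of_nat h) a * ff (of_nat (d - k)) b)"
    by (simp add: row_poly_def e c_def)
  show ?thesis
  proof (cases "a \<le> h \<and> b \<le> d - k")
    case False
    then have zero: "ff (of_nat h) a * ff (of_nat (d - k)) b = 0"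
      using ff_eq_0[of h a] ff_eq_0[of "d - k" b] by force
    show ?thesis unfolding row zero by (simp add: multidegree_0)
  next
    case True
    have "Poly_Mapping.keys c \<subseteq> {..<s} \<times> UNIV"
    proof
      fix v assume "v \<in> Poly_Mapping.keys c"
      then have "fst v = j"
        by (cases v) (auto simp: c_def in_keys_iff lookup_add lookup_single when_def split: if_splits)
      then show "v \<in> {..<s} \<times> UNIV" using assms(1) by (cases v) auto
    qed
    moreover have "(\<Sum>v\<in>UNIV. Poly_Mapping.lookup c (i, v)) = (if i = j then d - a - b else 0)" for i
      using True e by (auto simp: sum_3 c_def lookup_add lookup_single when_def)
    ultimately show ?thesis unfolding row multidegree_def by simp
  qed
qed

text \<open>Multiplying the matrix of conditions by a right inverse of its value at \<open>Ps\<^sub>0\<close> makes it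
  square, with determinant 1 at \<open>Ps\<^sub>0\<close>.\<close>

lemma for_general_points_if_rows_independent:
  assumes len: "length Ps0 = length ms"
    and nz: "\<forall>P\<in>set Ps0. rep_proj_plane P $ 2 \<noteq> 0"
    and indep: "\<And>\<nu>. (\<And>e. e \<in> triangle d \<Longrightarrow> (\<Sum>\<rho>\<in>rows ms. \<nu> \<rho> * row_coeff d Ps0 \<rho> e) = 0) \<Longrightarrow>
      \<forall>\<rho>\<in>rows ms. \<nu> \<rho> = 0"
    and less: "card (rows ms) < (d + 2) choose 2"
  shows "for_general_points (length ms) (h1_regular d ms)"
proof -
  obtain B where B: "\<And>\<rho> \<sigma>. \<rho> \<in> rows ms \<Longrightarrow> \<sigma> \<in> rows ms \<Longrightarrow>
      (\<Sum>e\<in>triangle d. B \<rho> e * row_coeff d Ps0 \<sigma> e) = (if \<rho> = \<sigma> then 1 else 0)"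
    using dual_family_exists[of "rows ms" "triangle d" "row_coeff d Ps0", OF finite_rows finite_triangle indep]
    by auto
  define n where "n = card (rows ms)"
  obtain f where f: "bij_betw f {..<n} (rows ms)"
    using ex_bij_betw_nat_finite[OF finite_rows[of ms]] by (auto simp: n_def atLeast0LessThan)
  have fR: "f i \<in> rows ms" if "i < n" for i using f that by (auto simp: bij_betw_def)
  define M where "M = (\<lambda>(i, i'). \<Sum>e\<in>triangle d.
      Poly_Mapping.single 0 (B (f i') e) * row_poly d (f i) e)"
  define Q :: "(nat \<times> 3) mpoly" where
    "Q = (\<Prod>j<length ms. Poly_Mapping.single (Poly_Mapping.single (j, 2) 1) 1)"
  define G where "G = Q * det (mat n n M)"
  have evalM: "mp_eval (M (i, i')) (coords Ps) =
      (\<Sum>e\<in>triangle d. B (f i') e * row_coeff d Ps (f i) e)" for i i' Ps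
    by (simp add: M_def mp_eval_sum mp_eval_mult mp_eval_row_poly)
  have evalG: "mp_eval G (coords Ps) = (\<Prod>j<length ms. rep_proj_plane (Ps ! j) $ 2) *
      det (mat n n (\<lambda>ij. mp_eval (M ij) (coords Ps)))" for Ps
    by (simp add: G_def Q_def mp_eval_mult mp_eval_prod mp_eval_det coords_def)
  define \<delta> where "\<delta> = (\<lambda>(j :: nat, a, b) i. if i = j then d - a - b else 0)"
  have "multihomogeneous (length ms) G"
  proof (rule multidegree_multihomogeneous)
    have "multidegree (length ms) (\<lambda>i. \<Sum>j<length ms. if i = j then 1 else 0) Q"
      unfolding Q_def by (rule multidegree_prod) (auto simp: multidegree_def lookup_single when_def)
    moreover have "multidegree (length ms) (\<lambda>k. \<Sum>i<n. \<delta> (f i) k) (det (mat n n M))"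
    proof (rule multidegree_det)
      fix i i' assume i: "i < n" "i' < n"
      obtain j a b where jab: "f i = (j, a, b)" by (cases "f i")
      have "j < length ms" using fR[OF i(1)] jab by (simp add: rows_def)
      then have "multidegree (length ms) (\<delta> (f i)) (row_poly d (f i) e)" if "e \<in> triangle d" for e
        using multidegree_row_poly that unfolding jab \<delta>_def by simp
      then have "multidegree (length ms) (\<delta> (f i)) (Poly_Mapping.single 0 c * row_poly d (f i) e)"
        if "e \<in> triangle d" for c e
        using multidegree_mult[OF multidegree_const, of "length ms" "\<delta> (f i)"] that by simp
      then show "multidegree (length ms) (\<delta> (f i)) (M (i, i'))"
        unfolding M_def prod.case by (intro multidegree_sum)
    qed
    ultimately show "multidegree (length ms)
        (\<lambda>k. (\<Sum>j<length ms. if k = j then 1 else 0) + (\<Sum>i<n. \<delta> (f i) k)) G"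
      unfolding G_def by (rule multidegree_mult)
  qed
  define U where "U = {Ps. length Ps = length ms \<and> mp_eval G (coords Ps) \<noteq> 0}"
  have "zariski_closed (length ms) ({Ps. length Ps = length ms} - U)"
    unfolding zariski_closed_def
    using \<open>multihomogeneous (length ms) G\<close> by (intro exI[of _ "{G}"]) (auto simp: U_def)
  then have "zariski_open (length ms) U" by (auto simp: zariski_open_def U_def)
  moreover have "Ps0 \<in> U"
  proof -
    have "mat n n (\<lambda>ij. mp_eval (M ij) (coords Ps0)) = 1\<^sub>m n"
    proof (rule eq_matI)
      fix i j assume ij: "i < dim_row (1\<^sub>m n)" "j < dim_col (1\<^sub>m n)"
      then have "i = j \<longleftrightarrow> f j = f i" using f by (auto simp: bij_betw_def dest: inj_onD)
      then show "mat n n (\<lambda>ij. mp_eval (M ij) (coords Ps0)) $$ (i, j) = 1\<^sub>m n $$ (i, j)"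
        using ij B[OF fR fR, of j i] by (simp add: evalM)
    qed auto
    then show ?thesis using nz len by (simp add: U_def evalG)
  qed
  moreover have "h1_regular d ms Ps" if "Ps \<in> U" for Ps
  proof (rule h1_regular_if_rows_independent[OF _ _ less])
    have G0: "mp_eval G (coords Ps) \<noteq> 0" using that by (simp add: U_def)
    then show "\<forall>i<length ms. rep_proj_plane (Ps ! i) $ 2 \<noteq> 0" by (auto simp: evalG)
    have det: "det (mat n n (\<lambda>ij. mp_eval (M ij) (coords Ps))) \<noteq> 0" using G0 by (simp add: evalG)
    fix \<nu> assume \<nu>: "\<And>e. e \<in> triangle d \<Longrightarrow> (\<Sum>\<rho>\<in>rows ms. \<nu> \<rho> * row_coeff d Ps \<rho> e) = 0"
    have "(\<Sum>i<n. \<nu> (f i) * mp_eval (M (i, j)) (coords Ps)) = 0" for j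
    proof -
      have "(\<Sum>i<n. \<nu> (f i) * mp_eval (M (i, j)) (coords Ps)) =
          (\<Sum>e\<in>triangle d. B (f j) e * (\<Sum>i<n. \<nu> (f i) * row_coeff d Ps (f i) e))"
        unfolding evalM sum_distrib_left by (subst sum.swap) (simp add: mult_ac)
      also have "\<dots> = (\<Sum>e\<in>triangle d. B (f j) e * (\<Sum>\<rho>\<in>rows ms. \<nu> \<rho> * row_coeff d Ps \<rho> e))"
        by (simp add: sum.reindex_bij_betw[OF f, of "\<lambda>\<rho>. \<nu> \<rho> * row_coeff d Ps \<rho> _"])
      finally show ?thesis by (simp add: \<nu>)
    qed
    then have "\<nu> (f i) = 0" if "i < n" for i
      using left_kernel_trivial[OF det, of "\<lambda>i. \<nu> (f i)"] that by blast
    then have "\<forall>\<rho>\<in>f ` {..<n}. \<nu> \<rho> = 0" by simp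
    then show "\<forall>\<rho>\<in>rows ms. \<nu> \<rho> = 0" using bij_betw_imp_surj_on[OF f] by simp
  qed
  ultimately show ?thesis unfolding for_general_points_def by blast
qed

lemma reduces_sequence:
  assumes "\<And>j. 1 \<le> j \<Longrightarrow> j \<le> length ms \<Longrightarrow> m_reducible (ms ! (j - 1)) (S j)"
    and "\<And>j. 1 \<le> j \<Longrightarrow> j \<le> length ms \<Longrightarrow>
           S (j + 1) = strip_zeros (the (m_reduction (ms ! (j - 1)) (S j)))"
  shows "reduces ms (S 1) (S (length ms + 1))"
  using assms
proof (induction ms arbitrary: S)
  case (Cons m ms)
  have "reduces ms (S (1 + 1)) (S (length ms + 1 + 1))"
  proof (rule Cons.IH[of "\<lambda>j. S (j + 1)"])
    fix j assume "1 \<le> j" "j \<le> length ms"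
    then show "m_reducible (ms ! (j - 1)) (S (j + 1))"
      "S (j + 1 + 1) = strip_zeros (the (m_reduction (ms ! (j - 1)) (S (j + 1))))"
      using Cons.prems(1)[of "j + 1"] Cons.prems(2)[of "j + 1"] by (auto simp: nth_Cons')
  qed
  moreover obtain U where "m_reduction m (S 1) = Some U"
    using Cons.prems(1)[of 1] by (auto simp: m_reducible_def)
  ultimately show ?case using Cons.prems(2)[of 1] by simp
qed simp

theorem theorem3p2:
  fixes d :: nat and ms :: "nat list" and S :: "nat \<Rightarrow> nat list"
  assumes "0 < d"
    and "\<forall>m\<in>set ms. 0 < m"
    and "S 1 = [1..<d + 2]"
    and "\<And>j. 1 \<le> j \<Longrightarrow> j \<le> length ms \<Longrightarrow> m_reducible (ms ! (j - 1)) (S j)"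
    and "\<And>j. 1 \<le> j \<Longrightarrow> j \<le> length ms \<Longrightarrow>
           S (j + 1) = strip_zeros (the (m_reduction (ms ! (j - 1)) (S j)))"
    and "0 < sum_list (S (length ms + 1))"
  shows "for_general_points (length ms) (h1_regular d ms)"
proof -
  have red: "reduces ms [1..<d + 2] (S (length ms + 1))"
    using reduces_sequence[OF assms(4,5)] by (simp only: assms(3))
  have less: "card (rows ms) < (d + 2) choose 2"
    using reduces_size[OF red] assms(6) by (simp only: sum_staircase)
  obtain Ps where Ps: "length Ps = length ms" "\<forall>P\<in>set Ps. rep_proj_plane P $ 2 \<noteq> 0"
    "\<And>\<nu>. (\<And>e. e \<in> triangle d \<Longrightarrow> (\<Sum>\<rho>\<in>rows ms. \<nu> \<rho> * row_coeff d Ps \<rho> e) = 0) \<Longrightarrow>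
      \<forall>\<rho>\<in>rows ms. \<nu> \<rho> = 0"
    using reduces_independent[OF red, of d] unfolding diagram_staircase triangle_def[symmetric] by blast
  show ?thesis
    by (rule for_general_points_if_rows_independent[OF Ps(1,2) _ less]) (rule Ps(3))
qed

end
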